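(* Let $n\ge3$ and let $\psi$ be a solution of the Schrödinger equation $$\frac1i\partial_t\psi-\tfrac12\Delta\psi+V(t,x)\psi=0,\qquad\psi|_{t=0}=\psi_0\in L^1(\mathbb{R}^n)\cap L^2(\mathbb{R}^n),$$ with a time-dependent potential $V(t,x)$ satisfying $$\sup_t\|V(t,\cdot)\|_{L^1\cap L^2}<\infty,\qquad \sup_t\|\hat V(t,\cdot)\|_{L^1}<\infty,$$ where $\hat V(t,\cdot)$ is the Fourier transform of $V$ in the spatial variable $x$ only. Assume that for some constant $C_1$ $$\|\psi(t)\|_{L^2+L^\infty}\le C_1\langle t\rangle^{-n/2}\|\psi_0\|_{L^1\cap L^2}\quad\text{for all }t\ge0.$$ Then there is a constant $C_2$, depending only on $n$, $C_1$ and the two suprema above, such that $$\|\psi(t)\|_{L^\infty}\le C_2\,|t|^{-n/2}\|\psi_0\|_{L^1\cap L^2}\quad\text{for all }t>0.$$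
   Context: Norms: $\|f\|_{L^2+L^\infty}=\inf_{f=h+g}(\|h\|_{L^2}+\|g\|_{L^\infty})$, $\|f\|_{L^1\cap L^2}=\|f\|_{L^1}+\|f\|_{L^2}$, $\langle t\rangle=(1+t^2)^{1/2}$. "Solution" means $\psi\in C([0,\infty);L^2)$ satisfying the Duhamel formula $\psi(t)=e^{it\Delta/2}\psi_0-i\int_0^te^{i(t-s)\Delta/2}V(s,\cdot)\psi(s)\,ds$. *)

theory Defs
  imports "HOL-Analysis.Analysis" "HOL-Probability.Essential_Supremum"
begin

text \<open>
  Elements of the Lebesgue spaces are represented by functions, and equality in these spaces is
  equality almost everywhere. The norms are extended nonnegative real numbers. Except for
  \<open>Linf_norm\<close> they are meaningful for Lebesgue measurable functions only, so measurability is
  always required separately.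
\<close>

definition L1_norm :: "('a::euclidean_space \<Rightarrow> complex) \<Rightarrow> ennreal" where
  "L1_norm f = (\<integral>\<^sup>+ x. ennreal (cmod (f x)) \<partial>lebesgue)"

definition L2_norm :: "('a::euclidean_space \<Rightarrow> complex) \<Rightarrow> ennreal" where
  "L2_norm f = (let J = (\<integral>\<^sup>+ x. ennreal ((cmod (f x))\<^sup>2) \<partial>lebesgue) in
     if J = \<infinity> then \<infinity> else ennreal (sqrt (enn2real J)))"

definition Linf_norm :: "('a::euclidean_space \<Rightarrow> complex) \<Rightarrow> ennreal" where
  "Linf_norm f = esssup lebesgue (\<lambda>x. ennreal (cmod (f x)))"

definition L1_cap_L2_norm :: "('a::euclidean_space \<Rightarrow> complex) \<Rightarrow> ennreal" where
  "L1_cap_L2_norm f = L1_norm f + L2_norm f"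

definition L2_plus_Linf_norm :: "('a::euclidean_space \<Rightarrow> complex) \<Rightarrow> ennreal" where
  "L2_plus_Linf_norm f = Inf {L2_norm h + Linf_norm g | h g.
     h \<in> borel_measurable lebesgue \<and> g \<in> borel_measurable lebesgue \<and>
     (AE x in lebesgue. f x = h x + g x)}"

definition L2_space :: "('a::euclidean_space \<Rightarrow> complex) set" where
  "L2_space = {f \<in> borel_measurable lebesgue. L2_norm f < \<infinity>}"

definition L1_cap_L2_space :: "('a::euclidean_space \<Rightarrow> complex) set" where
  "L1_cap_L2_space = {f \<in> borel_measurable lebesgue. L1_cap_L2_norm f < \<infinity>}"

definition fourier :: "('a::euclidean_space \<Rightarrow> complex) \<Rightarrow> 'a \<Rightarrow> complex" where
  "fourier f \<xi> = (LINT x|lebesgue. exp (- \<i> * complex_of_real (x \<bullet> \<xi>)) * f x)"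

text \<open>
  The Fourier transform on \<open>L\<^sup>2\<close> is the extension by continuity of the integral above from
  \<open>L\<^sup>1 \<inter> L\<^sup>2\<close>. It is given as a relation, because \<open>F\<close> is determined by \<open>f\<close> only up to null sets.
\<close>

definition L2_fourier ::
  "('a::euclidean_space \<Rightarrow> complex) \<Rightarrow> ('a \<Rightarrow> complex) \<Rightarrow> bool" where
  "L2_fourier f F \<longleftrightarrow> f \<in> L2_space \<and> F \<in> L2_space \<and>
     (\<exists>\<phi>. (\<forall>k::nat. \<phi> k \<in> L1_cap_L2_space) \<and>
        (\<lambda>k. L2_norm (\<lambda>x. \<phi> k x - f x)) \<longlonglongrightarrow> 0 \<and>
        (\<lambda>k. L2_norm (\<lambda>\<xi>. fourier (\<phi> k) \<xi> - F \<xi>)) \<longlonglongrightarrow> 0)"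

text \<open>
  \<open>free_evolution t f g\<close> says that \<open>g = e\<^bsup>it\<Delta>/2\<^esup> f\<close> in \<open>L\<^sup>2\<close>, where \<open>\<Delta>\<close> has the Fourier
  multiplier \<open>- |\<xi>|\<^sup>2\<close>.
\<close>

definition free_evolution ::
  "real \<Rightarrow> ('a::euclidean_space \<Rightarrow> complex) \<Rightarrow> ('a \<Rightarrow> complex) \<Rightarrow> bool" where
  "free_evolution t f g \<longleftrightarrow>
     (\<exists>F. L2_fourier f F \<and>
        L2_fourier g (\<lambda>\<xi>. exp (- \<i> * complex_of_real (t * (norm \<xi>)\<^sup>2 / 2)) * F \<xi>))"

text \<open>
  The Bochner integral of an \<open>L\<^sup>2\<close>-valued function, following \<^const>\<open>has_bochner_integral\<close>,
  which is not applicable because functions modulo null sets do not form a type here.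
  The distance of \<open>F u\<close> from the approximating simple functions is required to be measurable,
  since the nonnegative integral of a nonmeasurable function would only be a lower integral;
  together with the convergence this makes \<open>F\<close> strongly measurable.
\<close>

definition L2_simple :: "'s measure \<Rightarrow> ('s \<Rightarrow> 'a::euclidean_space \<Rightarrow> complex) \<Rightarrow> bool" where
  "L2_simple M s \<longleftrightarrow> simple_function M s \<and> (\<forall>u\<in>space M. s u \<in> L2_space) \<and>
     emeasure M {u \<in> space M. s u \<noteq> (\<lambda>_. 0)} \<noteq> \<infinity>"

definition L2_simple_integral ::
  "'s measure \<Rightarrow> ('s \<Rightarrow> 'a::euclidean_space \<Rightarrow> complex) \<Rightarrow> 'a \<Rightarrow> complex" where
  "L2_simple_integral M s x =
     (\<Sum>f\<in>s ` space M. complex_of_real (measure M {u \<in> space M. s u = f}) * f x)"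

definition has_L2_integral ::
  "'s measure \<Rightarrow> ('s \<Rightarrow> 'a::euclidean_space \<Rightarrow> complex) \<Rightarrow> ('a \<Rightarrow> complex) \<Rightarrow> bool" where
  "has_L2_integral M F I \<longleftrightarrow> (\<forall>u\<in>space M. F u \<in> L2_space) \<and> I \<in> L2_space \<and>
     (\<exists>s. (\<forall>k::nat. L2_simple M (s k)) \<and>
        (\<forall>k. (\<lambda>u. L2_norm (\<lambda>x. F u x - s k u x)) \<in> borel_measurable M) \<and>
        (\<lambda>k. \<integral>\<^sup>+ u. L2_norm (\<lambda>x. F u x - s k u x) \<partial>M) \<longlonglongrightarrow> 0 \<and>
        (\<lambda>k. L2_norm (\<lambda>x. L2_simple_integral M (s k) x - I x)) \<longlonglongrightarrow> 0)"

text \<open>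
  In the Duhamel formula below, \<open>G = e\<^bsup>it\<Delta>/2\<^esup> \<psi>0\<close>,
  \<open>F s = e\<^bsup>i(t-s)\<Delta>/2\<^esup> (V(s) \<psi>(s))\<close> and \<open>I\<close> is the integral of \<open>F\<close> over \<open>[0,t]\<close>.
\<close>

definition schroedinger_solution ::
  "(real \<Rightarrow> 'a::euclidean_space \<Rightarrow> complex) \<Rightarrow> ('a \<Rightarrow> complex) \<Rightarrow>
     (real \<Rightarrow> 'a \<Rightarrow> complex) \<Rightarrow> bool" where
  "schroedinger_solution V \<psi>0 \<psi> \<longleftrightarrow>
     (\<forall>t\<ge>0. \<psi> t \<in> L2_space) \<and>
     (\<forall>t\<ge>0. ((\<lambda>s. L2_norm (\<lambda>x. \<psi> s x - \<psi> t x)) \<longlongrightarrow> 0) (at t within {0..})) \<and>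
     (\<forall>t\<ge>0. \<exists>G F I.
        free_evolution t \<psi>0 G \<and>
        (\<forall>s\<in>{0..t}. free_evolution (t - s) (\<lambda>x. V s x * \<psi> s x) (F s)) \<and>
        has_L2_integral (lebesgue_on {0..t}) F I \<and>
        (AE x in lebesgue. \<psi> t x = G x - \<i> * I x))"

end

theory Submission
  imports Defs "HOL-Complex_Analysis.Conformal_Mappings" "HOL-Probability.Characteristic_Functions"
begin

text \<open>
  Fix \<open>t\<close> and consider \<open>\<phi>(s) = e\<^bsup>i(t-s)\<Delta>/2\<^esup> \<psi>(s)\<close>, so that
  \<open>\<phi>(s) = \<phi>(r) - i \<integral>\<^bsub>r\<^esub>\<^bsup>s\<^esup> W(\<tau>) \<phi>(\<tau>) d\<tau>\<close> with
  \<open>W(\<tau>) = e\<^bsup>i(t-\<tau>)\<Delta>/2\<^esup> V(\<tau>) e\<^bsup>-i(t-\<tau>)\<Delta>/2\<^esup>\<close>.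
  Conjugating the character \<open>e\<^bsup>ix\<xi>\<^esup>\<close> by the free evolution gives a translation followed by a
  character, hence by Fourier inversion \<open>W(\<tau>)\<close> is bounded on \<open>L\<^sup>\<infinity>\<close> and on \<open>L\<^sup>2\<close> by a multiple of
  the \<open>L\<^sup>1\<close> norm of the Fourier transform of \<open>V(\<tau>)\<close>. For \<open>r = max 0 (t - 1)\<close> the dispersive estimate
  and the assumed decay of \<open>\<psi>\<close> bound \<open>\<phi>(r)\<close> in \<open>L\<^sup>\<infinity>\<close> by a multiple of \<open>t\<^bsup>-n/2\<^esup>\<close>, and
  Gronwall's inequality on the interval from \<open>r\<close> to \<open>t\<close>, of length at most 1, bounds \<open>\<phi>(t) = \<psi>(t)\<close>.

  All of this is carried out weakly, by testing against Gaussian wave packets. Their free evolution is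
  explicit and they are permuted by the translations and characters above, up to phases. Therefore
  neither Plancherel's theorem nor the dispersive estimate is needed for general functions, and
  \<open>\<phi>(s)\<close> need not be constructed as a function.
\<close>

text \<open>The cut at distance 1 from \<open>t\<close> is forced. For \<open>n \<ge> 3\<close> the
  dispersive factor \<open>(t - \<tau>) powr (- n / 2)\<close> is not integrable at
  \<open>\<tau> = t\<close>, so it can serve only while \<open>t - \<tau> \<ge> 1\<close>; the
  remaining unit of time is where the integrability of the Fourier transform of \<open>V\<close>
  enters. On the other hand \<open>n / 2 > 1\<close> makes both decay factors integrable at
  infinity, so that their convolution decays like \<open>t powr (- n / 2)\<close> again. Gronwall's
  argument closes on the family of pairings with all packets of one fixed width parameter
  \<open>e\<close>: a character moves only the centres \<open>p\<close> and \<open>q\<close>, never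
  \<open>e\<close> or the time parameter. All bounds are uniform in \<open>e\<close> except the a
  priori bound that starts the iteration. At time \<open>t\<close> the packets with
  \<open>p = 0\<close> are plain Gaussians that concentrate at \<open>q\<close> as \<open>e\<close>
  tends to 0, and this is how bounds on pairings become bounds on values.\<close>

section \<open>Fubini for the completed Lebesgue measure with bounded kernels\<close>

lemma sigma_finite_lebesgue: "sigma_finite_measure (lebesgue :: 'a::euclidean_space measure)"
proof
  obtain A :: "'a set set" where "countable A" "A \<subseteq> sets lborel" "\<Union>A = space lborel"
      "\<forall>a\<in>A. emeasure lborel a \<noteq> \<infinity>"
    using lborel.sigma_finite_countable by auto
  then show "\<exists>A::'a set set. countable A \<and> A \<subseteq> sets lebesgue \<and> \<Union> A = space lebesgue \<and> (\<forall>a\<in>A. emeasure lebesgue a \<noteq> \<infinity>)"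
    by (intro exI[of _ A]) auto
qed

interpretation lebesgue: sigma_finite_measure lebesgue
  by (rule sigma_finite_lebesgue)

interpretation lebesgue_pair: pair_sigma_finite lebesgue lebesgue ..

lemma measurable_lebesgue_borel: "f \<in> borel_measurable borel \<Longrightarrow> f \<in> borel_measurable lebesgue"
  by (simp add: measurable_completion)

text \<open>The product sigma-algebra of two completions contains the Borel sets, but not every
  Lebesgue set, of the product space. Kernels are therefore kept Borel measurable, while each
  density may be Lebesgue measurable in its own variable.\<close>

lemma measurable_lebesgue_pair:
  fixes k :: "'a::euclidean_space \<times> 'b::euclidean_space \<Rightarrow> 'c::topological_space"
  assumes "k \<in> borel_measurable borel"
  shows "k \<in> borel_measurable (lebesgue \<Otimes>\<^sub>M lebesgue)"
proof -
  have [measurable]: "(\<lambda>x::'a. x) \<in> borel_measurable lebesgue" "(\<lambda>x::'b. x) \<in> borel_measurable lebesgue"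
    by (auto intro: measurable_lebesgue_borel)
  have "(\<lambda>p. (fst p, snd p)) \<in> (lebesgue \<Otimes>\<^sub>M lebesgue) \<rightarrow>\<^sub>M (borel \<Otimes>\<^sub>M borel :: ('a\<times>'b) measure)"
    by measurable
  then have "(\<lambda>p. p) \<in> (lebesgue \<Otimes>\<^sub>M lebesgue) \<rightarrow>\<^sub>M (borel :: ('a\<times>'b) measure)"
    by (simp add: borel_prod)
  from measurable_compose[OF this assms] show ?thesis by simp
qed

lemma integrable_lebesgue_pair_kernel:
  fixes f :: "'a::euclidean_space \<Rightarrow> complex" and g :: "'b::euclidean_space \<Rightarrow> complex"
  assumes f: "integrable lebesgue f" and g: "integrable lebesgue g"
    and k: "k \<in> borel_measurable borel" and K: "\<And>p. norm (k p) \<le> K"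
  shows "integrable (lebesgue \<Otimes>\<^sub>M lebesgue) (\<lambda>p. f (fst p) * g (snd p) * k p)"
proof -
  have [measurable]: "f \<in> borel_measurable lebesgue" "g \<in> borel_measurable lebesgue"
    using f g by auto
  have [measurable]: "k \<in> borel_measurable (lebesgue \<Otimes>\<^sub>M lebesgue)"
    using k by (rule measurable_lebesgue_pair)
  have "integrable (lebesgue \<Otimes>\<^sub>M lebesgue) (\<lambda>p. f (fst p) * g (snd p))"
    by (rule lebesgue_pair.Fubini_integrable) (use f g in \<open>auto simp: norm_mult\<close>)
  then have "integrable (lebesgue \<Otimes>\<^sub>M lebesgue) (\<lambda>p. complex_of_real K * (f (fst p) * g (snd p)))"
    by simp
  then show ?thesis
  proof (rule Bochner_Integration.integrable_bound)
    have "cmod (f (fst p) * g (snd p) * k p) \<le> cmod (f (fst p) * g (snd p)) * K" for p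
      using K[of p] by (simp add: norm_mult mult_left_mono)
    also have "\<dots> p \<le> norm (complex_of_real K * (f (fst p) * g (snd p)))" for p
      by (simp add: norm_mult mult.commute mult_mono)
    finally show "AE p in lebesgue \<Otimes>\<^sub>M lebesgue. norm (f (fst p) * g (snd p) * k p)
        \<le> norm (complex_of_real K * (f (fst p) * g (snd p)))"
      by simp
  qed measurable
qed

text \<open>Applied below with the Fourier kernel, with its conjugate, and with the Gaussian kernel
  of a difference, all of which are bounded.\<close>

lemma integral_kernel_swap:
  fixes f :: "'a::euclidean_space \<Rightarrow> complex" and g :: "'b::euclidean_space \<Rightarrow> complex"
  assumes f: "integrable lebesgue f" and g: "integrable lebesgue g"
    and k: "k \<in> borel_measurable borel" and K: "\<And>p. norm (k p) \<le> K"
  shows "(LINT x|lebesgue. f x * (LINT y|lebesgue. g y * k (x, y)))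
       = (LINT y|lebesgue. g y * (LINT x|lebesgue. f x * k (x, y)))"
proof -
  note i = integrable_lebesgue_pair_kernel[OF assms]
  have "(LINT y|lebesgue. LINT x|lebesgue. f x * g y * k (x,y))
      = (LINT x|lebesgue. LINT y|lebesgue. f x * g y * k (x,y))"
    using lebesgue_pair.Fubini_integral[of "\<lambda>x y. f x * g y * k (x,y)"] i
    by (simp add: case_prod_unfold)
  moreover have "(LINT x|lebesgue. f x * g y * k (x,y)) = g y * (LINT x|lebesgue. f x * k (x, y))" for y
    by (subst integral_mult_right_zero[symmetric]) (simp add: mult_ac)
  moreover have "(LINT y|lebesgue. f x * g y * k (x,y)) = f x * (LINT y|lebesgue. g y * k (x, y))" for x
    by (subst integral_mult_right_zero[symmetric]) (simp add: mult_ac)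
  ultimately show ?thesis by simp
qed

lemma borel_measurable_integral_kernel:
  fixes g :: "'b::euclidean_space \<Rightarrow> complex" and k :: "'a::euclidean_space \<times> 'b \<Rightarrow> complex"
  assumes g: "g \<in> borel_measurable lebesgue" and k: "k \<in> borel_measurable borel"
  shows "(\<lambda>x. LINT y|lebesgue. g y * k (x, y)) \<in> borel_measurable lebesgue"
proof -
  have [measurable]: "g \<in> borel_measurable lebesgue" by fact
  have [measurable]: "k \<in> borel_measurable (lebesgue \<Otimes>\<^sub>M lebesgue)"
    using k by (rule measurable_lebesgue_pair)
  show ?thesis
    by (rule lebesgue.borel_measurable_lebesgue_integral) measurable
qed

lemma norm_integral_kernel_le:
  fixes g :: "'b::euclidean_space \<Rightarrow> complex"
  assumes g: "integrable lebesgue g" and K: "\<And>y. norm (k y) \<le> K"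
  shows "norm (LINT y|lebesgue. g y * k y) \<le> K * (LINT y|lebesgue. norm (g y))"
proof -
  have "0 \<le> K" using K[of undefined] norm_ge_zero[of "k undefined"] by linarith
  have "norm (LINT y|lebesgue. g y * k y) \<le> (LINT y|lebesgue. norm (g y) * K)"
  proof (cases "integrable lebesgue (\<lambda>y. g y * k y)")
    case True
    then show ?thesis
      by (intro order_trans[OF integral_norm_bound] integral_mono integrable_norm)
         (use g K in \<open>auto simp: norm_mult mult_left_mono\<close>)
  next
    \<comment> \<open>The integral of a nonintegrable function is 0 by convention, so the bound
      persists.\<close>
    case False
    then show ?thesis using \<open>0 \<le> K\<close> by (simp add: not_integrable_integral_eq)
  qed
  then show ?thesis by (simp add: mult.commute)
qed

section \<open>Fourier transform of a real Gaussian\<close>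

lemma lborel_integral_prod:
  fixes f :: "'a::euclidean_space \<Rightarrow> real \<Rightarrow> complex"
  assumes f: "\<And>b. b \<in> Basis \<Longrightarrow> integrable lborel (f b)"
  shows "integrable lborel (\<lambda>x. \<Prod>b\<in>Basis. f b (x \<bullet> b))" (is ?I)
    and "(LINT x|lborel. (\<Prod>b\<in>Basis. f b (x \<bullet> b))) = (\<Prod>b\<in>Basis. LINT u|lborel. f b u)" (is ?E)
proof -
  interpret product_sigma_finite "\<lambda>_::'a. lborel :: real measure" ..
  have [measurable]: "b \<in> Basis \<Longrightarrow> f b \<in> borel_measurable borel" for b using f[of b] by auto
  have T[measurable]: "(\<lambda>f::'a\<Rightarrow>real. \<Sum>b\<in>Basis. f b *\<^sub>R b) \<in> (\<Pi>\<^sub>M b\<in>Basis. lborel) \<rightarrow>\<^sub>M borel"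
    by measurable
  have *: "(\<Prod>b\<in>Basis. f b ((\<Sum>b\<in>Basis. w b *\<^sub>R b) \<bullet> b)) = (\<Prod>b\<in>Basis. f b (w b))" for w
    by (auto intro!: prod.cong)
  show ?I
    by (subst lborel_eq, subst integrable_distr_eq) (auto simp: * intro!: product_integrable_prod f)
  show ?E
    by (subst lborel_eq, subst integral_distr) (auto simp: * intro!: product_integral_prod f)
qed

text \<open>Scaling by \<open>c = sqrt a\<close> reduces this to the characteristic function of the
  standard normal distribution at \<open>- (t / c)\<close>.\<close>

lemma real_gaussian_fourier:
  fixes a t :: real
  assumes a: "a > 0"
  shows "integrable lborel (\<lambda>u. exp (- \<i> * of_real (t * u)) * exp (- of_real (a * u\<^sup>2 / 2)))" (is ?I)
    and "(LINT u|lborel. exp (- \<i> * of_real (t * u)) * exp (- of_real (a * u\<^sup>2 / 2)))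
           = of_real (sqrt (2 * pi / a) * exp (- t\<^sup>2 / (2 * a)))" (is ?E)
proof -
  define c where "c = sqrt a"
  have c: "c > 0" "c\<^sup>2 = a" using a by (auto simp: c_def)
  define h where "h = (\<lambda>u::real. std_normal_density u *\<^sub>R iexp (- (t / c) * u))"
  have ih: "integrable lborel h"
    unfolding h_def
    by (rule Bochner_Integration.integrable_bound[OF integrable_normal_density[of 1 0]]) auto
  have "char std_normal_distribution (- (t / c)) = (LINT u|lborel. h u)"
    unfolding char_def h_def by (subst integral_density) auto
  then have eh: "(LINT u|lborel. h u) = exp (- ((t / c)\<^sup>2) / 2)"
    by (simp add: char_std_normal_distribution)
  have fe: "exp (- \<i> * of_real (t * u)) * exp (- of_real (a * u\<^sup>2 / 2)) = sqrt (2 * pi) *\<^sub>R h (0 + c * u)" for u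
    using c(1) by (simp add: h_def std_normal_density_def scaleR_conv_of_real power_mult_distrib flip: exp_of_real c(2))
  show ?I unfolding fe
    by (intro integrable_scaleR_right) (use lborel_integrable_real_affine[OF ih, of c 0] c in auto)
  have "(LINT u|lborel. h u) = c *\<^sub>R (LINT u|lborel. h (0 + c * u))"
    using lborel_integral_real_affine[of c h 0] c by simp
  then have "(LINT u|lborel. h (0 + c * u)) = exp (- ((t / c)\<^sup>2) / 2) / c"
    using c unfolding eh by (simp add: scaleR_conv_of_real field_simps)
  then show ?E unfolding fe using c
    by (simp add: scaleR_conv_of_real real_sqrt_divide c_def[symmetric] power_divide exp_of_real[symmetric] field_simps)
qed

lemma exp_norm_square_prod:
  "exp (- complex_of_real (a * (norm (x::'a::euclidean_space))\<^sup>2 / 2)) = (\<Prod>b\<in>Basis. exp (- of_real (a * (x \<bullet> b)\<^sup>2 / 2)))"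
proof -
  have "(norm x)\<^sup>2 = (\<Sum>b\<in>Basis. (x \<bullet> b)\<^sup>2)"
    by (subst power2_norm_eq_inner, subst euclidean_inner) (simp add: power2_eq_square)
  then show ?thesis
    by (simp add: sum_distrib_left sum_divide_distrib sum_negf exp_sum flip: sum_negf)
qed

lemma gaussian_fourier_of_real:
  fixes x :: "'a::euclidean_space"
  assumes a: "a > 0"
  shows "integrable lborel (\<lambda>\<xi>. exp (- \<i> * of_real (x \<bullet> \<xi>)) * exp (- of_real (a * (norm \<xi>)\<^sup>2 / 2)))" (is ?I)
    and "(LINT \<xi>|lborel. exp (- \<i> * of_real (x \<bullet> \<xi>)) * exp (- of_real (a * (norm \<xi>)\<^sup>2 / 2)))
           = of_real (sqrt (2 * pi / a)) ^ DIM('a) * exp (- of_real ((norm x)\<^sup>2 / (2 * a)))" (is ?E)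
proof -
  have fe: "exp (- \<i> * of_real (x \<bullet> \<xi>)) * exp (- of_real (a * (norm \<xi>)\<^sup>2 / 2))
      = (\<Prod>b\<in>Basis. exp (- \<i> * of_real ((x \<bullet> b) * (\<xi> \<bullet> b))) * exp (- of_real (a * (\<xi> \<bullet> b)\<^sup>2 / 2)))" for \<xi>
  proof -
    have "exp (- \<i> * complex_of_real (x \<bullet> \<xi>)) = (\<Prod>b\<in>Basis. exp (- \<i> * of_real ((x \<bullet> b) * (\<xi> \<bullet> b))))"
      by (subst euclidean_inner) (simp add: sum_distrib_left flip: exp_sum sum_negf)
    then show ?thesis by (simp only: exp_norm_square_prod prod.distrib)
  qed
  show ?I unfolding fe
    by (rule lborel_integral_prod(1)[of "\<lambda>b u. exp (- \<i> * of_real ((x \<bullet> b) * u)) * exp (- of_real (a * u\<^sup>2 / 2))"])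
       (rule real_gaussian_fourier(1)[OF a])
  have "(norm x)\<^sup>2 = (\<Sum>b\<in>Basis. (x \<bullet> b)\<^sup>2)"
    by (subst power2_norm_eq_inner, subst euclidean_inner) (simp add: power2_eq_square)
  then have "exp (- complex_of_real ((norm x)\<^sup>2 / (2 * a))) = (\<Prod>b\<in>Basis. exp (- of_real ((x \<bullet> b)\<^sup>2 / (2 * a))))"
    by (simp add: sum_divide_distrib flip: exp_sum sum_negf)
  then show ?E unfolding fe
    using lborel_integral_prod(2)[of "\<lambda>b u. exp (- \<i> * of_real ((x \<bullet> b) * u)) * exp (- of_real (a * u\<^sup>2 / 2))",
        OF real_gaussian_fourier(1)[OF a]] real_gaussian_fourier(2)[OF a]
    by (simp add: prod.distrib flip: exp_of_real)
qed

section \<open>Gaussian integrals\<close>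

text \<open>Closed form of the Fourier transform of a Gaussian with complex parameter
  \<open>z\<close>. Taking a power of \<open>csqrt\<close> rather than a root of a power selects the
  right branch: for \<open>Re z > 0\<close> the argument of \<open>csqrt\<close> stays in the right
  half plane, whereas its \<open>DIM('a)\<close>-th power may wind around the origin.\<close>

definition gauss :: "complex \<Rightarrow> 'a::euclidean_space \<Rightarrow> complex" where
  "gauss z x = csqrt (2 * of_real pi / z) ^ DIM('a) * exp (- of_real ((norm x)\<^sup>2) / (2 * z))"

lemma integrable_exp_norm_square:
  assumes "a > 0"
  shows "integrable lborel (\<lambda>x::'a::euclidean_space. exp (- (a * (norm x)\<^sup>2 / 2)))"
proof -
  have "integrable lborel (\<lambda>\<xi>. Re (exp (- \<i> * of_real ((0::'a) \<bullet> \<xi>)) * exp (- of_real (a * (norm \<xi>)\<^sup>2 / 2))))"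
    by (intro integrable_Re gaussian_fourier_of_real(1) assms)
  then show ?thesis by (simp add: Re_exp)
qed

lemma integral_exp_norm_square:
  assumes "a > 0"
  shows "(LINT x::'a::euclidean_space|lborel. exp (- (a * (norm x)\<^sup>2 / 2))) = sqrt (2 * pi / a) ^ DIM('a)"
proof -
  have "complex_of_real (LINT x::'a|lborel. exp (- (a * (norm x)\<^sup>2 / 2)))
      = (LINT x::'a|lborel. exp (- of_real (a * (norm x)\<^sup>2 / 2)))"
    unfolding integral_complex_of_real[symmetric] by (simp only: exp_of_real flip: of_real_minus)
  also have "\<dots> = of_real (sqrt (2 * pi / a) ^ DIM('a))"
    using gaussian_fourier_of_real(2)[OF assms, of "0::'a"] by simp
  finally show ?thesis by (simp only: of_real_eq_iff)
qed

lemma integrable_gaussian_fourier: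
  fixes x :: "'a::euclidean_space"
  assumes z: "Re z > 0"
  shows "integrable lborel (\<lambda>\<xi>. exp (- \<i> * of_real (x \<bullet> \<xi>)) * exp (- (z * of_real ((norm \<xi>)\<^sup>2) / 2)))"
proof (rule Bochner_Integration.integrable_bound[OF integrable_exp_norm_square[OF z]])
  show "AE \<xi>::'a in lborel. cmod (exp (- \<i> * complex_of_real (x \<bullet> \<xi>)) * exp (- (z * of_real ((norm \<xi>)\<^sup>2) / 2)))
      \<le> norm (exp (- (Re z * (norm \<xi>)\<^sup>2 / 2)))"
    by (simp add: norm_mult)
qed measurable

text \<open>Over a compact box one may differentiate under the integral. As the boxes exhaust the
  space, the truncated integrals converge locally uniformly in \<open>z\<close>, and holomorphy
  passes to the limit.\<close>

lemma gaussian_fourier_holomorphic: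
  fixes x :: "'a::euclidean_space"
  shows "(\<lambda>z. LINT \<xi>|lborel. exp (- \<i> * of_real (x \<bullet> \<xi>)) * exp (- (z * of_real ((norm \<xi>)\<^sup>2) / 2)))
    holomorphic_on {z. Re z > 0}"
proof -
  define f where "f = (\<lambda>z \<xi>. exp (- \<i> * of_real (x \<bullet> \<xi>)) * exp (- (z * of_real ((norm \<xi>)\<^sup>2) / 2)))"
  define B where "B = (\<lambda>N::nat. cbox (- real N *\<^sub>R One) (real N *\<^sub>R One) :: 'a set)"
  show ?thesis
  proof (rule holomorphic_uniform_sequence[where f = "\<lambda>N z. integral (B N) (f z)"])
    show "open {z. Re z > 0}" by (rule open_halfspace_Re_gt)
    have f_int: "f z integrable_on cbox a b" for z a b
      unfolding f_def by (intro integrable_continuous continuous_intros) auto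
    show "(\<lambda>z. integral (B N) (f z)) holomorphic_on {z. Re z > 0}" for N
      unfolding B_def
    proof (rule leibniz_rule_holomorphic)
      show "((\<lambda>z. f z t) has_field_derivative (- (of_real ((norm t)\<^sup>2) / 2) * f z t)) (at z within {z. Re z > 0})" for z t
        unfolding f_def by (auto intro!: derivative_eq_intros)
      show "continuous_on ({z. 0 < Re z} \<times> cbox (- real N *\<^sub>R One) (real N *\<^sub>R One))
           (\<lambda>(z, t). - (of_real ((norm t)\<^sup>2) / 2) * f z t)"
        unfolding f_def case_prod_unfold by (intro continuous_intros) auto
      show "convex {z. 0 < Re z}" by (rule convex_halfspace_Re_gt)
    qed (rule f_int)
    show "\<exists>d>0. cball z0 d \<subseteq> {z. 0 < Re z} \<and>
        uniform_limit (cball z0 d) (\<lambda>N z. integral (B N) (f z)) (\<lambda>z. LINT \<xi>|lborel. exp (- \<i> * of_real (x \<bullet> \<xi>)) * exp (- (z * of_real ((norm \<xi>)\<^sup>2) / 2))) sequentially"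
      if "z0 \<in> {z. 0 < Re z}" for z0
    proof -
      \<comment> \<open>On \<open>cball z0 a\<close> the real part is still at least
        \<open>a\<close>, so one real Gaussian dominates all integrands, and its tail outside the
        box bounds the truncation error uniformly in \<open>z\<close>.\<close>
      define a where "a = Re z0 / 2"
      have a: "a > 0" using that by (simp add: a_def)
      have Re_ge: "Re z \<ge> a" if "z \<in> cball z0 a" for z
      proof -
        have "\<bar>Re (z0 - z)\<bar> \<le> a"
          using that abs_Re_le_cmod[of "z0 - z"] by (auto simp: dist_norm)
        then show ?thesis unfolding a_def minus_complex.simps by linarith
      qed
      then have sub: "cball z0 a \<subseteq> {z. 0 < Re z}" using a by force
      define g where "g = (\<lambda>\<xi>::'a. exp (- (a * (norm \<xi>)\<^sup>2 / 2)))"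
      have g: "integrable lborel g" unfolding g_def by (rule integrable_exp_norm_square[OF a])
      have [measurable]: "B N \<in> sets borel" for N by (simp add: B_def)
      have lim: "(\<lambda>N. LINT \<xi>|lborel. indicator (- B N) \<xi> * g \<xi>) \<longlonglongrightarrow> (LINT \<xi>::'a|lborel. 0)"
      proof (rule integral_dominated_convergence[where w = g])
        show "AE \<xi> in lborel. (\<lambda>N. indicator (- B N) \<xi> * g \<xi>) \<longlonglongrightarrow> 0"
        proof (intro AE_I2)
          fix \<xi> :: 'a
          obtain N0 :: nat where N0: "norm \<xi> \<le> N0" using real_arch_simple by blast
          have "\<xi> \<in> B N" if "N \<ge> N0" for N
            unfolding B_def mem_box
          proof safe
            fix b :: 'a assume b: "b \<in> Basis"
            have "\<bar>\<xi> \<bullet> b\<bar> \<le> N" using Basis_le_norm[OF b, of \<xi>] N0 that by linarith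
            then show "- real N *\<^sub>R One \<bullet> b \<le> \<xi> \<bullet> b" "\<xi> \<bullet> b \<le> real N *\<^sub>R One \<bullet> b"
              using b by auto
          qed
          then have "\<forall>\<^sub>F N in sequentially. indicator (- B N) \<xi> * g \<xi> = 0"
            by (auto intro!: eventually_sequentiallyI[of N0])
          then show "(\<lambda>N. indicator (- B N) \<xi> * g \<xi>) \<longlonglongrightarrow> 0"
            by (rule tendsto_eventually)
        qed
      qed (use g in \<open>auto simp: g_def indicator_def\<close>)
      have bd: "dist (integral (B N) (f z)) (LINT \<xi>|lborel. f z \<xi>) \<le> (LINT \<xi>|lborel. indicator (- B N) \<xi> * g \<xi>)"
        if z: "z \<in> cball z0 a" for z N
      proof -
        have fz: "integrable lborel (f z)"
          unfolding f_def using Re_ge[OF z] a by (intro integrable_gaussian_fourier) simp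
        then have fB: "integrable lborel (\<lambda>\<xi>. indicator (B N) \<xi> *\<^sub>R f z \<xi>)"
          by (intro integrable_mult_indicator) auto
        have fC: "integrable lborel (\<lambda>\<xi>. indicator (- B N) \<xi> *\<^sub>R f z \<xi>)"
          by (rule integrable_mult_indicator[OF _ fz]) auto
        have "integral (B N) (f z) = (LINT \<xi>|lborel. indicator (B N) \<xi> *\<^sub>R f z \<xi>)"
          using set_borel_integral_eq_integral(2)[of "B N" "f z"] fB
          by (simp add: set_integrable_def set_lebesgue_integral_def)
        moreover have "(LINT \<xi>|lborel. f z \<xi>) = (LINT \<xi>|lborel. indicator (B N) \<xi> *\<^sub>R f z \<xi> + indicator (- B N) \<xi> *\<^sub>R f z \<xi>)"
          by (intro Bochner_Integration.integral_cong) (auto simp: indicator_def)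
        ultimately have "dist (integral (B N) (f z)) (LINT \<xi>|lborel. f z \<xi>) = norm (LINT \<xi>|lborel. indicator (- B N) \<xi> *\<^sub>R f z \<xi>)"
          using fB fC by (simp add: dist_norm norm_minus_commute)
        also have "\<dots> \<le> (LINT \<xi>|lborel. norm (indicator (- B N) \<xi> *\<^sub>R f z \<xi>))"
          by (rule integral_norm_bound)
        also have "\<dots> \<le> (LINT \<xi>|lborel. indicator (- B N) \<xi> * g \<xi>)"
        proof (rule integral_mono)
          show "integrable lborel (\<lambda>\<xi>. norm (indicator (- B N) \<xi> *\<^sub>R f z \<xi>))"
            using fC by (rule integrable_norm)
          show "integrable lborel (\<lambda>\<xi>. indicator (- B N) \<xi> * g \<xi>)"
            using integrable_mult_indicator[OF _ g, of "- B N"] by simp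
          show "norm (indicator (- B N) \<xi> *\<^sub>R f z \<xi>) \<le> indicator (- B N) \<xi> * g \<xi>" for \<xi>
            using Re_ge[OF z] by (auto simp: f_def g_def indicator_def norm_mult mult_right_mono)
        qed
        finally show ?thesis .
      qed
      have "uniform_limit (cball z0 a) (\<lambda>N z. integral (B N) (f z)) (\<lambda>z. LINT \<xi>|lborel. f z \<xi>) sequentially"
      proof (rule uniform_limitI)
        fix e :: real assume "e > 0"
        with lim have "\<forall>\<^sub>F N in sequentially. (LINT \<xi>|lborel. indicator (- B N) \<xi> * g \<xi>) < e"
          by (auto dest: order_tendstoD(2))
        then show "\<forall>\<^sub>F N in sequentially. \<forall>z\<in>cball z0 a. dist (integral (B N) (f z)) (LINT \<xi>|lborel. f z \<xi>) < e"
        proof (rule eventually_mono, intro ballI)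
          fix N z
          assume "(LINT \<xi>|lborel. indicator (- B N) \<xi> * g \<xi>) < e" "z \<in> cball z0 a"
          then show "dist (integral (B N) (f z)) (LINT \<xi>|lborel. f z \<xi>) < e"
            using bd[of z N] by linarith
        qed
      qed
      with a sub show ?thesis unfolding f_def by blast
    qed
  qed
qed

lemma gauss_holomorphic:
  "(\<lambda>z. gauss z (x::'a::euclidean_space)) holomorphic_on {z. Re z > 0}"
proof -
  have "2 * complex_of_real pi / z \<notin> \<real>\<^sub>\<le>\<^sub>0" if "Re z > 0" for z
  proof -
    have "Re (2 * complex_of_real pi / z) = (2 * pi) * Re z / (cmod z)\<^sup>2"
      by (simp add: Re_divide cmod_power2)
    also have "\<dots> > 0" using that by (intro divide_pos_pos mult_pos_pos) auto
    finally show ?thesis by (auto simp: complex_nonpos_Reals_iff)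
  qed
  then show ?thesis
    unfolding gauss_def by (auto intro!: holomorphic_intros)
qed

lemma gauss_of_real:
  fixes x :: "'a::euclidean_space"
  assumes "e > 0"
  shows "gauss (of_real e) x = of_real (sqrt (2 * pi / e) ^ DIM('a) * exp (- ((norm x)\<^sup>2 / (2 * e))))"
proof -
  have "2 * complex_of_real pi / of_real e = of_real (2 * pi / e)"
       "- complex_of_real ((norm x)\<^sup>2) / (2 * of_real e) = of_real (- ((norm x)\<^sup>2 / (2 * e)))"
    by simp_all
  then show ?thesis
    unfolding gauss_def using assms by (simp only: exp_of_real of_real_sqrt[symmetric] of_real_mult of_real_power divide_nonneg_pos mult_nonneg_nonneg pi_ge_zero zero_le_numeral)
qed

text \<open>Both sides are holomorphic in \<open>z\<close>, so it suffices that they agree for real \<open>z\<close>.\<close>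

lemma gaussian_fourier:
  fixes x :: "'a::euclidean_space"
  assumes z: "Re z > 0"
  shows "(LINT \<xi>|lborel. exp (- \<i> * of_real (x \<bullet> \<xi>)) * exp (- (z * of_real ((norm \<xi>)\<^sup>2) / 2))) = gauss z x"
proof -
  let ?F = "\<lambda>z. LINT \<xi>|lborel. exp (- \<i> * of_real (x \<bullet> \<xi>)) * exp (- (z * of_real ((norm \<xi>)\<^sup>2) / 2))"
  have "?F z - gauss z x = 0"
  proof (rule analytic_continuation[where f = "\<lambda>z. ?F z - gauss z x" and U = "of_real ` {0<..}" and \<xi> = 1])
    show "(\<lambda>z. ?F z - gauss z x) holomorphic_on {z. Re z > 0}"
      by (intro holomorphic_intros gaussian_fourier_holomorphic gauss_holomorphic)
    show "connected {z. Re z > 0}" by (intro convex_connected convex_halfspace_Re_gt)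
    show "1 islimpt complex_of_real ` {0<..}"
    proof -
      have "(\<lambda>n. complex_of_real (1 + 1 / real (Suc n))) \<longlonglongrightarrow> of_real (1 + 0)"
        by (intro tendsto_intros) (rule lim_1_over_n[THEN LIMSEQ_Suc])
      then show ?thesis
        unfolding islimpt_sequential
        by (intro exI[of _ "\<lambda>n. complex_of_real (1 + 1 / real (Suc n))"])
           (auto simp del: of_real_add of_real_divide intro!: imageI add_pos_nonneg)
    qed
    show "?F w - gauss w x = 0" if "w \<in> complex_of_real ` {0<..}" for w
    proof -
      from that obtain a where a: "a > 0" "w = of_real a" by auto
      show ?thesis using gaussian_fourier_of_real(2)[OF a(1), of x] a(1)
        by (simp add: gauss_of_real a(2) flip: exp_of_real)
    qed
  qed (use z in \<open>auto simp: open_halfspace_Re_gt\<close>)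
  then show ?thesis by simp
qed

lemma cmod_gauss:
  fixes x :: "'a::euclidean_space"
  assumes z: "Re z > 0"
  shows "cmod (gauss z x) = sqrt (2 * pi / cmod z) ^ DIM('a) * exp (- (Re z / (cmod z)\<^sup>2 * (norm x)\<^sup>2 / 2))"
proof -
  have "4 * (Re z)\<^sup>2 + 4 * (Im z)\<^sup>2 > 0" "(Re z)\<^sup>2 * 2 + (Im z)\<^sup>2 * 2 > 0"
    using z by (auto intro!: add_pos_nonneg)
  then have "Re (- complex_of_real ((norm x)\<^sup>2) / (2 * z)) = - (Re z / (cmod z)\<^sup>2 * (norm x)\<^sup>2 / 2)"
    by (simp add: Re_divide cmod_power2 power_mult_distrib frac_eq_eq algebra_simps)
  then show ?thesis
    by (simp add: gauss_def norm_mult norm_power norm_divide)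
qed

lemma gauss_measurable [measurable]: "gauss z \<in> borel_measurable borel"
  unfolding gauss_def by measurable

section \<open>Gaussian wave packets\<close>

text \<open>A function of frequency: \<open>p\<close> is the mean frequency, \<open>q\<close> a
  position encoded as a linear phase, and \<open>s\<close> an elapsed time encoded as the quadratic
  phase of the free propagator. With \<open>s\<close> among the parameters the family is closed
  under the free evolution.\<close>

definition packet :: "real \<Rightarrow> real \<Rightarrow> 'a::euclidean_space \<Rightarrow> 'a \<Rightarrow> 'a \<Rightarrow> complex" where
  "packet e s p q \<xi> = exp (of_real (- (e * (norm (\<xi> - p))\<^sup>2 / 2)) + \<i> * of_real (q \<bullet> \<xi> - s * (norm \<xi>)\<^sup>2 / 2))"

text \<open>The same packet in physical space: its complex width parameter is
  \<open>e + \<i> s\<close>, and its centre \<open>q - s *\<^sub>R p\<close> moves along a straight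
  line.\<close>

definition packet_ft :: "real \<Rightarrow> real \<Rightarrow> 'a::euclidean_space \<Rightarrow> 'a \<Rightarrow> 'a \<Rightarrow> complex" where
  "packet_ft e s p q x = exp (\<i> * of_real (q \<bullet> p - x \<bullet> p - s * (norm p)\<^sup>2 / 2)) * gauss (Complex e s) (x - q + s *\<^sub>R p)"

lemma integral_lborel_shift:
  fixes f :: "'a::euclidean_space \<Rightarrow> 'b::{banach, second_countable_topology}"
  assumes "f \<in> borel_measurable borel"
  shows "(LINT x|lborel. f x) = (LINT x|lborel. f (a + x))"
  by (subst lborel_distr_plus[symmetric, of a], subst integral_distr) (use assms in auto)

lemma integrable_lborel_shift:
  fixes f :: "'a::euclidean_space \<Rightarrow> 'b::{banach, second_countable_topology}"
  assumes "f \<in> borel_measurable borel"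
  shows "integrable lborel f \<longleftrightarrow> integrable lborel (\<lambda>x. f (a + x))"
  by (subst lborel_distr_plus[symmetric, of a], subst integrable_distr_eq) (use assms in auto)

lemma cmod_packet: "cmod (packet e s p q \<xi>) = exp (- (e * (norm (\<xi> - p))\<^sup>2 / 2))"
  by (simp add: packet_def)

lemma packet_measurable [measurable]: "packet e s p q \<in> borel_measurable borel"
  unfolding packet_def by measurable

lemma packet_ft_measurable [measurable]: "packet_ft e s p q \<in> borel_measurable borel"
  unfolding packet_ft_def by measurable

lemma integrable_packet:
  fixes p q :: "'a::euclidean_space"
  assumes "e > 0"
  shows "integrable lebesgue (packet e s p q)"
proof -
  have "integrable lborel (\<lambda>\<xi>::'a. exp (- (e * (norm (\<xi> - p))\<^sup>2 / 2)))"
    using integrable_exp_norm_square[OF assms]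
    by (subst integrable_lborel_shift[where a = p]) auto
  then have "integrable lborel (packet e s p q)"
    by (rule Bochner_Integration.integrable_bound) (auto simp: cmod_packet)
  then show ?thesis by (simp add: integrable_completion)
qed

lemma packet_evolve:
  "exp (- \<i> * of_real (s' * (norm \<xi>)\<^sup>2 / 2)) * packet e s p q \<xi> = packet e (s + s') p q \<xi>"
  unfolding packet_def exp_add[symmetric] by (rule arg_cong[where f = exp]) (simp add: algebra_simps add_divide_distrib)

lemma norm_add_power2: "(norm (x + y))\<^sup>2 = (norm x)\<^sup>2 + 2 * (x \<bullet> y) + (norm (y::'a::real_inner))\<^sup>2"
  by (simp add: power2_norm_eq_inner inner_add inner_commute)

text \<open>Once the origin is moved to \<open>p\<close>, the cross term of the quadratic phase
  becomes linear in \<open>\<xi>\<close> and shifts \<open>x - q\<close> to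
  \<open>x - q + s *\<^sub>R p\<close>. What remains is the Gaussian integral with parameter
  \<open>e + \<i> s\<close>, times a constant phase.\<close>

lemma fourier_packet:
  fixes p q x :: "'a::euclidean_space"
  assumes "e > 0"
  shows "fourier (packet e s p q) x = packet_ft e s p q x"
proof -
  let ?y = "x - q + s *\<^sub>R p"
  have "fourier (packet e s p q) x = (LINT \<xi>|lborel. exp (- \<i> * of_real (\<xi> \<bullet> x)) * packet e s p q \<xi>)"
    unfolding fourier_def by (rule integral_completion) measurable
  also have "\<dots> = (LINT \<xi>|lborel. exp (- \<i> * of_real ((p + \<xi>) \<bullet> x)) * packet e s p q (p + \<xi>))"
    by (rule integral_lborel_shift) measurable
  also have "\<dots> = (LINT \<xi>|lborel. exp (\<i> * of_real (q \<bullet> p - x \<bullet> p - s * (norm p)\<^sup>2 / 2)) *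
      (exp (- \<i> * of_real (?y \<bullet> \<xi>)) * exp (- (Complex e s * of_real ((norm \<xi>)\<^sup>2) / 2))))"
  proof (rule Bochner_Integration.integral_cong[OF refl])
    fix \<xi> :: 'a
    show "exp (- \<i> * of_real ((p + \<xi>) \<bullet> x)) * packet e s p q (p + \<xi>)
        = exp (\<i> * of_real (q \<bullet> p - x \<bullet> p - s * (norm p)\<^sup>2 / 2)) *
      (exp (- \<i> * of_real (?y \<bullet> \<xi>)) * exp (- (Complex e s * of_real ((norm \<xi>)\<^sup>2) / 2)))"
      unfolding packet_def exp_add[symmetric] norm_add_power2
      by (rule arg_cong[where f = exp])
         (simp add: complex_eq_iff inner_add inner_diff inner_commute algebra_simps add_divide_distrib)
  qed
  also have "\<dots> = exp (\<i> * of_real (q \<bullet> p - x \<bullet> p - s * (norm p)\<^sup>2 / 2)) *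
    (LINT \<xi>|lborel. (exp (- \<i> * of_real (?y \<bullet> \<xi>)) * exp (- (Complex e s * of_real ((norm \<xi>)\<^sup>2) / 2))))"
    by (rule integral_mult_right_zero)
  also have "\<dots> = packet_ft e s p q x"
    unfolding packet_ft_def using assms by (subst gaussian_fourier) auto
  finally show ?thesis .
qed

text \<open>The packets are invariant under Galilean boosts.\<close>

lemma packet_ft_modulate:
  fixes p q x \<eta> :: "'a::euclidean_space" and s :: real
  defines "c \<equiv> q \<bullet> p - s * (norm p)\<^sup>2 / 2 - (q - s *\<^sub>R \<eta>) \<bullet> (p - \<eta>) + s * (norm (p - \<eta>))\<^sup>2 / 2"
  shows "exp (\<i> * of_real (x \<bullet> \<eta>)) * packet_ft e s p q x
       = exp (\<i> * of_real c) * packet_ft e s (p - \<eta>) (q - s *\<^sub>R \<eta>) x"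
proof -
  have 1: "x - (q - s *\<^sub>R \<eta>) + s *\<^sub>R (p - \<eta>) = x - q + s *\<^sub>R p"
    by (simp add: algebra_simps)
  show ?thesis unfolding packet_ft_def 1 mult.assoc[symmetric] exp_add[symmetric]
    by (rule arg_cong2[where f = "(*)"], rule arg_cong[where f = exp])
       (simp_all add: c_def algebra_simps inner_diff)
qed

lemma cmod_packet_ft:
  fixes x :: "'a::euclidean_space"
  assumes "e > 0"
  shows "cmod (packet_ft e s p q x) = sqrt (2 * pi / cmod (Complex e s)) ^ DIM('a) *
    exp (- (e / (cmod (Complex e s))\<^sup>2 * (norm (x - q + s *\<^sub>R p))\<^sup>2 / 2))"
  using assms by (simp add: packet_ft_def norm_mult cmod_gauss)

text \<open>The dispersive estimate for packets: since \<open>s\<close> is at most the modulus of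
  \<open>e + \<i> s\<close>, the peak height is bounded uniformly in the width and the
  centres.\<close>

lemma cmod_packet_ft_le_time:
  fixes x :: "'a::euclidean_space"
  assumes "e > 0" "s > 0"
  shows "cmod (packet_ft e s p q x) \<le> sqrt (2 * pi / s) ^ DIM('a)"
proof -
  have s: "s \<le> cmod (Complex e s)" using abs_Im_le_cmod[of "Complex e s"] by simp
  have "cmod (packet_ft e s p q x) \<le> sqrt (2 * pi / cmod (Complex e s)) ^ DIM('a) * 1"
    unfolding cmod_packet_ft[OF assms(1)] using assms by (intro mult_left_mono) auto
  also have "\<dots> \<le> sqrt (2 * pi / s) ^ DIM('a) * 1"
    using assms s by (intro mult_right_mono power_mono real_sqrt_le_mono divide_left_mono mult_pos_pos) auto
  finally show ?thesis by simp
qed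

text \<open>That this does not depend on \<open>s\<close> reflects that the free evolution is unitary.\<close>

lemma nn_integral_packet_ft_square:
  fixes p q :: "'a::euclidean_space"
  assumes e: "e > 0"
  shows "(\<integral>\<^sup>+x. ennreal ((cmod (packet_ft e s p q x))\<^sup>2) \<partial>lebesgue) = ennreal ((2 * pi * sqrt (pi / e)) ^ DIM('a))"
proof -
  define r where "r = cmod (Complex e s)"
  have r: "r > 0" using e abs_Re_le_cmod[of "Complex e s"] unfolding r_def complex.sel by linarith
  define a where "a = 2 * e / r\<^sup>2"
  have a: "a > 0" using e r by (simp add: a_def)
  have sq: "(cmod (packet_ft e s p q x))\<^sup>2 = (2 * pi / r) ^ DIM('a) * exp (- (a * (norm (x - q + s *\<^sub>R p))\<^sup>2 / 2))" for x
    using r unfolding cmod_packet_ft[OF e] r_def[symmetric] power_mult_distrib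
    by (simp add: a_def power2_eq_square flip: power_mult_distrib exp_add real_sqrt_mult)
  have "(\<integral>\<^sup>+x. ennreal ((cmod (packet_ft e s p q x))\<^sup>2) \<partial>lebesgue)
      = (\<integral>\<^sup>+x. ennreal ((2 * pi / r) ^ DIM('a) * exp (- (a * (norm (x - q + s *\<^sub>R p))\<^sup>2 / 2))) \<partial>lborel)"
    unfolding sq by (simp add: nn_integral_completion)
  also have "\<dots> = (\<integral>\<^sup>+x. ennreal ((2 * pi / r) ^ DIM('a) * exp (- (a * (norm x)\<^sup>2 / 2))) \<partial>distr lborel borel ((+) (- q + s *\<^sub>R p)))"
    by (subst nn_integral_distr) (auto simp: algebra_simps)
  also have "\<dots> = ennreal (LINT x::'a|lborel. (2 * pi / r) ^ DIM('a) * exp (- (a * (norm x)\<^sup>2 / 2)))"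
    unfolding lborel_distr_plus
    by (rule nn_integral_eq_integral) (use r integrable_exp_norm_square[OF a] in auto)
  also have "\<dots> = ennreal ((2 * pi / r * sqrt (2 * pi / a)) ^ DIM('a))"
    by (simp only: integral_mult_right_zero integral_exp_norm_square[OF a] power_mult_distrib)
  \<comment> \<open>In each dimension the squared height is proportional to \<open>1 / r\<close> and
    the width to \<open>r\<close>; thus \<open>r\<close>, which alone carries \<open>s\<close>,
    cancels.\<close>
  also have "2 * pi / r * sqrt (2 * pi / a) = 2 * pi * sqrt (pi / e)"
    using r e by (simp add: a_def real_sqrt_divide real_sqrt_mult)
  finally show ?thesis .
qed

section \<open>Pairings in the space of square integrable functions and the multiplication
  formula\<close>

lemma ennreal_power2_le_iff: "(a::ennreal)\<^sup>2 \<le> b\<^sup>2 \<longleftrightarrow> a \<le> b"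
proof
  show "a \<le> b" if "a\<^sup>2 \<le> b\<^sup>2"
    using that by (cases a; cases b) (auto simp: ennreal_power top_power_ennreal top_unique)
qed (rule power_mono; simp)

lemma L2_norm_square: "(L2_norm f)\<^sup>2 = (\<integral>\<^sup>+ x. ennreal ((cmod (f x))\<^sup>2) \<partial>lebesgue)"
proof (cases "(\<integral>\<^sup>+ x. ennreal ((cmod (f x))\<^sup>2) \<partial>lebesgue)")
  case (real r)
  then show ?thesis by (simp add: L2_norm_def Let_def ennreal_power)
next
  case top
  then show ?thesis by (simp add: L2_norm_def Let_def top_power_ennreal)
qed

lemma L2_space_measurable: "f \<in> L2_space \<Longrightarrow> f \<in> borel_measurable lebesgue"
  by (simp add: L2_space_def)

lemma L2_norm_mult_bound:
  fixes f g :: "'a::euclidean_space \<Rightarrow> complex"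
  assumes [measurable]: "f \<in> borel_measurable lebesgue" "g \<in> borel_measurable lebesgue"
  shows "L1_norm (\<lambda>x. f x * g x) \<le> L2_norm f * L2_norm g"
proof -
  have "(L1_norm (\<lambda>x. f x * g x))\<^sup>2 = (\<integral>\<^sup>+x. ennreal (cmod (f x)) * ennreal (cmod (g x)) \<partial>lebesgue)\<^sup>2"
    by (simp add: L1_norm_def norm_mult ennreal_mult)
  also have "\<dots> \<le> (L2_norm f)\<^sup>2 * (L2_norm g)\<^sup>2"
    unfolding L2_norm_square ennreal_power[OF norm_ge_zero, symmetric]
    by (rule Cauchy_Schwarz_nn_integral) auto
  finally show ?thesis by (simp add: power_mult_distrib[symmetric] ennreal_power2_le_iff)
qed

lemma integrable_iff_L1_norm:
  fixes f :: "'a::euclidean_space \<Rightarrow> complex"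
  shows "integrable lebesgue f \<longleftrightarrow> f \<in> borel_measurable lebesgue \<and> L1_norm f < \<infinity>"
  by (simp add: integrable_iff_bounded L1_norm_def)

lemma integrable_mult_L2:
  fixes f g :: "'a::euclidean_space \<Rightarrow> complex"
  assumes "f \<in> L2_space" "g \<in> L2_space"
  shows "integrable lebesgue (\<lambda>x. f x * g x)"
proof -
  have "L1_norm (\<lambda>x. f x * g x) \<le> L2_norm f * L2_norm g"
    using assms by (intro L2_norm_mult_bound) (auto simp: L2_space_def)
  also have "\<dots> < \<infinity>" using assms by (auto simp: L2_space_def ennreal_mult_less_top)
  finally show ?thesis using assms by (auto simp: integrable_iff_L1_norm L2_space_def)
qed

lemma cmod_integral_le_L1_norm:
  fixes f :: "'a::euclidean_space \<Rightarrow> complex"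
  shows "ennreal (cmod (LINT x|lebesgue. f x)) \<le> L1_norm f"
proof (cases "integrable lebesgue f")
  case True
  then show ?thesis unfolding L1_norm_def by (rule integral_norm_bound_ennreal)
qed (simp add: not_integrable_integral_eq)

lemma cmod_integral_diff_le_L2:
  fixes f f' g :: "'a::euclidean_space \<Rightarrow> complex"
  assumes [measurable]: "f \<in> borel_measurable lebesgue" "f' \<in> borel_measurable lebesgue" "g \<in> borel_measurable lebesgue"
    and "integrable lebesgue (\<lambda>x. f x * g x)" "integrable lebesgue (\<lambda>x. f' x * g x)"
  shows "ennreal (cmod ((LINT x|lebesgue. f x * g x) - (LINT x|lebesgue. f' x * g x))) \<le> L2_norm (\<lambda>x. f x - f' x) * L2_norm g"
proof -
  have "(LINT x|lebesgue. f x * g x) - (LINT x|lebesgue. f' x * g x) = (LINT x|lebesgue. (f x - f' x) * g x)"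
    using assms by (simp add: left_diff_distrib)
  also have "ennreal (cmod \<dots>) \<le> L1_norm (\<lambda>x. (f x - f' x) * g x)"
    by (rule cmod_integral_le_L1_norm)
  also have "\<dots> \<le> L2_norm (\<lambda>x. f x - f' x) * L2_norm g"
    by (rule L2_norm_mult_bound) measurable
  finally show ?thesis .
qed

text \<open>Integrability is required of the products and not of the squares of
  \<open>\<phi> k\<close>, because one application has Fourier transforms in place of
  \<open>\<phi> k\<close>, about which only boundedness has been established.\<close>

lemma tendsto_integral_mult_L2:
  fixes f :: "'a::euclidean_space \<Rightarrow> complex"
  assumes [measurable]: "\<And>k. \<phi> k \<in> borel_measurable lebesgue" and f [measurable]: "f \<in> borel_measurable lebesgue"
    and g: "g \<in> L2_space"
    and "\<And>k. integrable lebesgue (\<lambda>x. \<phi> k x * g x)" "integrable lebesgue (\<lambda>x. f x * g x)"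
    and lim: "((\<lambda>k. L2_norm (\<lambda>x. \<phi> k x - f x)) \<longlongrightarrow> 0) F"
  shows "((\<lambda>k. LINT x|lebesgue. \<phi> k x * g x) \<longlongrightarrow> (LINT x|lebesgue. f x * g x)) F"
proof -
  have [measurable]: "g \<in> borel_measurable lebesgue" using g by (rule L2_space_measurable)
  have "((\<lambda>k. L2_norm (\<lambda>x. \<phi> k x - f x) * L2_norm g) \<longlongrightarrow> 0 * L2_norm g) F"
    using g by (intro tendsto_mult_ennreal lim tendsto_const) (auto simp: L2_space_def)
  then have lim0: "((\<lambda>k. L2_norm (\<lambda>x. \<phi> k x - f x) * L2_norm g) \<longlongrightarrow> 0) F" by simp
  have "((\<lambda>k. ennreal (cmod ((LINT x|lebesgue. \<phi> k x * g x) - (LINT x|lebesgue. f x * g x)))) \<longlongrightarrow> ennreal 0) F"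
  proof (rule tendsto_sandwich[where f = "\<lambda>_. ennreal 0" and h = "\<lambda>k. L2_norm (\<lambda>x. \<phi> k x - f x) * L2_norm g"])
    show "\<forall>\<^sub>F k in F. ennreal (cmod ((LINT x|lebesgue. \<phi> k x * g x) - (LINT x|lebesgue. f x * g x)))
        \<le> L2_norm (\<lambda>x. \<phi> k x - f x) * L2_norm g"
      by (intro always_eventually allI cmod_integral_diff_le_L2) (use assms in auto)
    show "((\<lambda>k. L2_norm (\<lambda>x. \<phi> k x - f x) * L2_norm g) \<longlongrightarrow> ennreal 0) F"
      using lim0 by simp
    show "((\<lambda>_. ennreal 0) \<longlongrightarrow> ennreal 0) F" by (rule tendsto_const)
  qed simp
  then have "((\<lambda>k. cmod ((LINT x|lebesgue. \<phi> k x * g x) - (LINT x|lebesgue. f x * g x))) \<longlongrightarrow> 0) F"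
    by (subst (asm) tendsto_ennreal_iff) auto
  then show ?thesis by (rule LIM_zero_cancel[OF tendsto_norm_zero_cancel])
qed

lemma packet_ft_L2:
  assumes "e > 0" shows "packet_ft e s p q \<in> L2_space"
proof -
  have "(L2_norm (packet_ft e s p q))\<^sup>2 < \<infinity>"
    unfolding L2_norm_square nn_integral_packet_ft_square[OF assms] by simp
  then have "L2_norm (packet_ft e s p q) < \<infinity>"
    by (cases "L2_norm (packet_ft e s p q)") (auto simp: top_power_ennreal)
  then show ?thesis by (simp add: L2_space_def measurable_lebesgue_borel)
qed

lemma packet_L2:
  assumes "e > 0" shows "packet e s p q \<in> L2_space"
proof -
  have "(L2_norm (packet e s p q))\<^sup>2 \<le> L1_norm (packet e s p q)"
    unfolding L2_norm_square L1_norm_def using assms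
    by (intro nn_integral_mono ennreal_leI) (auto simp: cmod_packet power2_eq_square intro!: mult_left_le)
  also have "\<dots> < \<infinity>" using integrable_packet[OF assms] integrable_iff_L1_norm by blast
  finally have "L2_norm (packet e s p q) < \<infinity>"
    by (cases "L2_norm (packet e s p q)") (auto simp: top_power_ennreal)
  then show ?thesis by (simp add: L2_space_def measurable_lebesgue_borel)
qed

lemma fourier_measurable:
  fixes f :: "'a::euclidean_space \<Rightarrow> complex"
  assumes "f \<in> borel_measurable lebesgue"
  shows "fourier f \<in> borel_measurable lebesgue"
proof -
  have "(\<lambda>p::'a \<times> 'a. exp (- \<i> * complex_of_real (snd p \<bullet> fst p))) \<in> borel_measurable borel"
    by (intro borel_measurable_continuous_onI continuous_intros)
  from borel_measurable_integral_kernel[OF assms this] show ?thesis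
    by (simp add: fourier_def[abs_def] mult.commute)
qed

lemma cmod_fourier_le:
  fixes f :: "'a::euclidean_space \<Rightarrow> complex"
  assumes "integrable lebesgue f"
  shows "cmod (fourier f \<xi>) \<le> (LINT x|lebesgue. cmod (f x))"
  using norm_integral_kernel_le[OF assms, of "\<lambda>x. exp (- \<i> * of_real (x \<bullet> \<xi>))" 1]
  by (simp add: fourier_def mult.commute)

lemma integral_fourier_mult:
  fixes f g :: "'a::euclidean_space \<Rightarrow> complex"
  assumes "integrable lebesgue f" "integrable lebesgue g"
  shows "(LINT \<xi>|lebesgue. fourier f \<xi> * g \<xi>) = (LINT x|lebesgue. f x * fourier g x)"
proof -
  have "(\<lambda>p::'a \<times> 'a. exp (- \<i> * complex_of_real (fst p \<bullet> snd p))) \<in> borel_measurable borel"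
    by (intro borel_measurable_continuous_onI continuous_intros)
  from integral_kernel_swap[OF assms this, of 1] show ?thesis
    by (simp add: fourier_def inner_commute mult.commute)
qed

lemma integrable_bounded_mult:
  fixes f g :: "'a::euclidean_space \<Rightarrow> complex"
  assumes f: "f \<in> borel_measurable lebesgue" and K: "\<And>x. cmod (f x) \<le> K" and g: "integrable lebesgue g"
  shows "integrable lebesgue (\<lambda>x. f x * g x)"
proof (rule Bochner_Integration.integrable_bound)
  have [measurable]: "f \<in> borel_measurable lebesgue" "g \<in> borel_measurable lebesgue" using f g by auto
  show "integrable lebesgue (\<lambda>x. complex_of_real K * g x)" using g by simp
  show "(\<lambda>x. f x * g x) \<in> borel_measurable lebesgue" by measurable
  have "cmod (f x) \<le> \<bar>K\<bar>" for x using K[of x] by linarith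
  then show "AE x in lebesgue. cmod (f x * g x) \<le> cmod (complex_of_real K * g x)"
    by (simp add: norm_mult mult_right_mono)
qed

text \<open>The multiplication formula of \<open>integral_fourier_mult\<close> holds for each
  approximant. Both sides pass to the limit because the packet and its transform are square
  integrable.\<close>

lemma L2_fourier_packet:
  fixes f F :: "'a::euclidean_space \<Rightarrow> complex"
  assumes "L2_fourier f F" and e: "e > 0"
  shows "(LINT \<xi>|lebesgue. F \<xi> * packet e s p q \<xi>) = (LINT x|lebesgue. f x * packet_ft e s p q x)"
proof -
  obtain \<phi> :: "nat \<Rightarrow> 'a \<Rightarrow> complex" where L2: "f \<in> L2_space" "F \<in> L2_space"
    and \<phi>: "\<And>k. \<phi> k \<in> L1_cap_L2_space"
    and lim: "(\<lambda>k. L2_norm (\<lambda>x. \<phi> k x - f x)) \<longlonglongrightarrow> 0" "(\<lambda>k. L2_norm (\<lambda>\<xi>. fourier (\<phi> k) \<xi> - F \<xi>)) \<longlonglongrightarrow> 0"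
    using assms(1) unfolding L2_fourier_def by blast
  have \<phi>1: "integrable lebesgue (\<phi> k)" and \<phi>2: "\<phi> k \<in> L2_space" for k
    using \<phi>[of k] by (auto simp: L1_cap_L2_space_def L1_cap_L2_norm_def integrable_iff_L1_norm L2_space_def)
  have m: "\<phi> k \<in> borel_measurable lebesgue" "fourier (\<phi> k) \<in> borel_measurable lebesgue" for k
    using \<phi>1[of k] by (auto intro: fourier_measurable)
  have "(\<lambda>k. LINT \<xi>|lebesgue. fourier (\<phi> k) \<xi> * packet e s p q \<xi>) \<longlonglongrightarrow> (LINT \<xi>|lebesgue. F \<xi> * packet e s p q \<xi>)"
    by (intro tendsto_integral_mult_L2 m L2_space_measurable L2 packet_L2 e lim integrable_mult_L2
              integrable_bounded_mult[OF _ cmod_fourier_le[OF \<phi>1]] integrable_packet)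
  moreover have "(LINT \<xi>|lebesgue. fourier (\<phi> k) \<xi> * packet e s p q \<xi>) = (LINT x|lebesgue. \<phi> k x * packet_ft e s p q x)" for k
    using integral_fourier_mult[OF \<phi>1 integrable_packet[OF e]] by (simp add: fourier_packet[OF e])
  moreover have "(\<lambda>k. LINT x|lebesgue. \<phi> k x * packet_ft e s p q x) \<longlonglongrightarrow> (LINT x|lebesgue. f x * packet_ft e s p q x)"
    by (intro tendsto_integral_mult_L2 m L2_space_measurable L2 packet_ft_L2 e lim integrable_mult_L2 \<phi>2)
  ultimately show ?thesis using LIMSEQ_unique by simp
qed

text \<open>The pairing is bilinear, without conjugation, so the propagator moves onto the packet
  with its sign unchanged and is absorbed there by adding \<open>s'\<close> to the time
  parameter.\<close>

lemma free_evolution_packet: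
  fixes f g :: "'a::euclidean_space \<Rightarrow> complex"
  assumes "free_evolution s' f g" and e: "e > 0"
  shows "(LINT x|lebesgue. g x * packet_ft e s p q x) = (LINT x|lebesgue. f x * packet_ft e (s + s') p q x)"
proof -
  obtain F where F: "L2_fourier f F"
    and G: "L2_fourier g (\<lambda>\<xi>. exp (- \<i> * of_real (s' * (norm \<xi>)\<^sup>2 / 2)) * F \<xi>)" (is "L2_fourier g ?G")
    using assms(1) unfolding free_evolution_def by blast
  have "(LINT x|lebesgue. g x * packet_ft e s p q x) = (LINT \<xi>|lebesgue. ?G \<xi> * packet e s p q \<xi>)"
    using L2_fourier_packet[OF G e] by simp
  also have "\<dots> = (LINT \<xi>|lebesgue. F \<xi> * packet e (s + s') p q \<xi>)"
    unfolding packet_evolve[symmetric] by (simp add: mult_ac)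
  also have "\<dots> = (LINT x|lebesgue. f x * packet_ft e (s + s') p q x)"
    by (rule L2_fourier_packet[OF F e])
  finally show ?thesis .
qed

section \<open>Approximation of the identity and Fourier inversion\<close>

lemma integral_lborel_affine:
  fixes f :: "'a::euclidean_space \<Rightarrow> 'b::{banach, second_countable_topology}"
  assumes [measurable]: "f \<in> borel_measurable borel" and c: "c \<noteq> 0"
  shows "(LINT x|lborel. f x) = \<bar>c\<bar> ^ DIM('a) *\<^sub>R (LINT x|lborel. f (t + c *\<^sub>R x))"
  by (subst lborel_affine[OF c, of t], subst integral_density, simp_all)
     (subst integral_distr, simp_all)

text \<open>The substitution \<open>y = x - c *\<^sub>R u\<close> moves the width \<open>c\<close>
  into the indicator. The Gaussian left over does not depend on \<open>c\<close> and can serve as a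
  dominating function.\<close>

lemma cbox_gauss_convolution:
  fixes x :: "'a::euclidean_space"
  assumes c: "c > 0"
  shows "(LINT y|lebesgue. of_real (indicator (cbox a b) y) * gauss (of_real (c\<^sup>2)) (x - y))
    = (LINT u|lborel. of_real (indicator (cbox a b) (x - c *\<^sub>R u) * (sqrt (2 * pi) ^ DIM('a) * exp (- ((norm u)\<^sup>2 / 2)))))"
proof -
  have "(LINT y|lebesgue. of_real (indicator (cbox a b) y) * gauss (of_real (c\<^sup>2)) (x - y))
      = (LINT y|lborel. of_real (indicator (cbox a b) y) * gauss (of_real (c\<^sup>2)) (x - y))"
    by (rule integral_completion) measurable
  also have "\<dots> = \<bar>- c\<bar> ^ DIM('a) *\<^sub>R (LINT u|lborel. of_real (indicator (cbox a b) (x + - c *\<^sub>R u)) * gauss (of_real (c\<^sup>2)) (x - (x + - c *\<^sub>R u)))"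
    by (rule integral_lborel_affine, measurable) (use c in simp)
  also have "\<dots> = (LINT u|lborel. \<bar>- c\<bar> ^ DIM('a) *\<^sub>R (of_real (indicator (cbox a b) (x + - c *\<^sub>R u)) * gauss (of_real (c\<^sup>2)) (x - (x + - c *\<^sub>R u))))"
    unfolding scaleR_conv_of_real by (rule integral_mult_right_zero[symmetric])
  also have "\<dots> = (LINT u|lborel. of_real (indicator (cbox a b) (x - c *\<^sub>R u) * (sqrt (2 * pi) ^ DIM('a) * exp (- ((norm u)\<^sup>2 / 2)))))"
  proof (rule Bochner_Integration.integral_cong[OF refl])
    fix u :: 'a
    have "c ^ DIM('a) * (sqrt (2 * pi / c\<^sup>2) ^ DIM('a) * exp (- ((norm (c *\<^sub>R u))\<^sup>2 / (2 * c\<^sup>2))))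
        = sqrt (2 * pi) ^ DIM('a) * exp (- ((norm u)\<^sup>2 / 2))"
      using c by (simp add: real_sqrt_divide power_mult_distrib power_divide)
    moreover have "gauss (of_real (c\<^sup>2)) (c *\<^sub>R u) = of_real (sqrt (2 * pi / c\<^sup>2) ^ DIM('a) * exp (- ((norm (c *\<^sub>R u))\<^sup>2 / (2 * c\<^sup>2))))"
      by (rule gauss_of_real) (use c in simp)
    ultimately have "\<bar>- c\<bar> ^ DIM('a) *\<^sub>R gauss (of_real (c\<^sup>2)) (c *\<^sub>R u) = of_real (sqrt (2 * pi) ^ DIM('a) * exp (- ((norm u)\<^sup>2 / 2)))"
      using c by (simp only: scaleR_conv_of_real abs_minus_cancel abs_of_pos flip: of_real_mult)
    then show "\<bar>- c\<bar> ^ DIM('a) *\<^sub>R (of_real (indicator (cbox a b) (x + - c *\<^sub>R u)) * gauss (of_real (c\<^sup>2)) (x - (x + - c *\<^sub>R u)))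
        = of_real (indicator (cbox a b) (x - c *\<^sub>R u) * (sqrt (2 * pi) ^ DIM('a) * exp (- ((norm u)\<^sup>2 / 2))))"
      by (simp add: indicator_def)
  qed
  finally show ?thesis .
qed

lemma integrable_std_gauss:
  "integrable lborel (\<lambda>u::'a::euclidean_space. sqrt (2 * pi) ^ DIM('a) * exp (- ((norm u)\<^sup>2 / 2)))"
  using integrable_exp_norm_square[of 1, where 'a = 'a] by simp

lemma integral_std_gauss:
  "(LINT u::'a::euclidean_space|lborel. sqrt (2 * pi) ^ DIM('a) * exp (- ((norm u)\<^sup>2 / 2))) = (2 * pi) ^ DIM('a)"
proof -
  have "(LINT u::'a|lborel. exp (- ((norm u)\<^sup>2 / 2))) = sqrt (2 * pi) ^ DIM('a)"
    using integral_exp_norm_square[of 1, where 'a = 'a] by simp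
  then show ?thesis
    by (simp only: integral_mult_right_zero power_mult_distrib[symmetric]) simp
qed

lemma cbox_gauss_convolution_bound:
  fixes x :: "'a::euclidean_space"
  assumes c: "c > 0"
  shows "cmod (LINT y|lebesgue. of_real (indicator (cbox a b) y) * gauss (of_real (c\<^sup>2)) (x - y)) \<le> (2 * pi) ^ DIM('a)"
  unfolding cbox_gauss_convolution[OF c] integral_std_gauss[symmetric] integral_complex_of_real norm_of_real
proof -
  let ?G = "\<lambda>u::'a. sqrt (2 * pi) ^ DIM('a) * exp (- ((norm u)\<^sup>2 / 2))"
  have "0 \<le> (LINT u|lborel. indicator (cbox a b) (x - c *\<^sub>R u) * ?G u)"
    by (rule integral_nonneg_AE) simp
  moreover have "(LINT u|lborel. indicator (cbox a b) (x - c *\<^sub>R u) * ?G u) \<le> (LINT u|lborel. ?G u)"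
    by (rule integral_mono'[OF integrable_std_gauss]) (auto simp: indicator_def)
  ultimately show "\<bar>LINT u|lborel. indicator (cbox a b) (x - c *\<^sub>R u) * ?G u\<bar> \<le> (LINT u|lborel. ?G u)"
    by linarith
qed

text \<open>Off the frontier the indicator is locally constant, so for each \<open>u\<close> the
  integrand is eventually equal to its limit.\<close>

lemma cbox_gauss_convolution_tendsto:
  fixes x :: "'a::euclidean_space"
  assumes c: "\<And>n. c n > 0" "c \<longlonglongrightarrow> 0" and x: "x \<notin> frontier (cbox a b)"
  shows "(\<lambda>n::nat. LINT y|lebesgue. of_real (indicator (cbox a b) y) * gauss (of_real ((c n)\<^sup>2)) (x - y))
    \<longlonglongrightarrow> of_real (indicator (cbox a b) x * (2 * pi) ^ DIM('a))"
proof -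
  let ?G = "\<lambda>u::'a. sqrt (2 * pi) ^ DIM('a) * exp (- ((norm u)\<^sup>2 / 2))"
  have "(\<lambda>n. LINT u|lborel. indicator (cbox a b) (x - c n *\<^sub>R u) * ?G u) \<longlonglongrightarrow> (LINT u|lborel. indicator (cbox a b) x * ?G u)"
  proof (rule integral_dominated_convergence[where w = ?G])
    show "integrable lborel ?G" by (rule integrable_std_gauss)
    show "AE u in lborel. (\<lambda>n. indicator (cbox a b) (x - c n *\<^sub>R u) * ?G u) \<longlonglongrightarrow> indicator (cbox a b) x * ?G u"
    proof (intro AE_I2 tendsto_mult tendsto_const)
      fix u :: 'a
      have lim: "(\<lambda>n. x - c n *\<^sub>R u) \<longlonglongrightarrow> x - 0 *\<^sub>R u" by (intro tendsto_intros c)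
      have "\<forall>\<^sub>F n in sequentially. indicator (cbox a b) (x - c n *\<^sub>R u) = (indicator (cbox a b) x :: real)"
      proof (cases "x \<in> cbox a b")
        case True
        then have "x \<in> interior (cbox a b)" using x by (auto simp: frontier_def)
        with lim have "\<forall>\<^sub>F n in sequentially. x - c n *\<^sub>R u \<in> interior (cbox a b)"
          by (intro topological_tendstoD[of _ x]) auto
        then show ?thesis using True box_subset_cbox[of a b] by (auto elim!: eventually_mono simp: indicator_def)
      next
        case False
        with lim have "\<forall>\<^sub>F n in sequentially. x - c n *\<^sub>R u \<in> - cbox a b"
          by (intro topological_tendstoD[of _ x]) (auto intro: closed_cbox)
        then show ?thesis using False by (auto elim!: eventually_mono)
      qed
      then show "(\<lambda>n. indicator (cbox a b) (x - c n *\<^sub>R u) :: real) \<longlonglongrightarrow> indicator (cbox a b) x"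
        by (rule tendsto_eventually)
    qed
  qed (auto simp: indicator_def)
  then have "(\<lambda>n. of_real (LINT u|lborel. indicator (cbox a b) (x - c n *\<^sub>R u) * ?G u)) \<longlonglongrightarrow> complex_of_real (LINT u|lborel. indicator (cbox a b) x * ?G u)"
    by (rule tendsto_of_real)
  moreover have "(LINT u|lborel. indicator (cbox a b) x * ?G u) = indicator (cbox a b) x * (2 * pi) ^ DIM('a)"
    by (subst integral_mult_right_zero, subst integral_std_gauss) (rule refl)
  ultimately show ?thesis
    unfolding cbox_gauss_convolution[OF c(1)] integral_complex_of_real by (simp only:)
qed

lemma integrable_cbox:
  fixes a b :: "'a::euclidean_space"
  shows "integrable lebesgue (\<lambda>y. complex_of_real (indicator (cbox a b) y))"
proof -
  have "integrable lebesgue (indicat_real (cbox a b))"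
    by (rule integrable_real_indicator) (auto simp: emeasure_lborel_cbox_eq)
  then show ?thesis by simp
qed

lemma gauss_kernel_measurable: "(\<lambda>p::'a::euclidean_space \<times> 'a. gauss z (fst p - snd p)) \<in> borel_measurable borel"
  using measurable_compose[OF _ gauss_measurable, of "\<lambda>p::'a \<times> 'a. fst p - snd p" borel]
  by (simp add: borel_measurable_continuous_onI continuous_intros)

lemma cmod_gauss_le:
  fixes x :: "'a::euclidean_space"
  assumes "e > 0" shows "cmod (gauss (of_real e) x) \<le> sqrt (2 * pi / e) ^ DIM('a)"
  unfolding gauss_of_real[OF assms] using assms by (auto simp: norm_mult norm_power intro!: mult_left_le)

text \<open>Fubini moves the smoothing from \<open>f\<close> onto the indicator of the box, where
  pointwise convergence holds off the frontier, a null set.\<close>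

lemma integral_cbox_convolution_tendsto:
  fixes f :: "'a::euclidean_space \<Rightarrow> complex"
  assumes f: "integrable lebesgue f" and c: "\<And>n. c n > 0" "c \<longlonglongrightarrow> 0"
  shows "(\<lambda>n::nat. LINT y|lebesgue. of_real (indicator (cbox a b) y) * (LINT x|lebesgue. f x * gauss (of_real ((c n)\<^sup>2)) (x - y)))
    \<longlonglongrightarrow> of_real ((2 * pi) ^ DIM('a)) * (LINT x|lebesgue. of_real (indicator (cbox a b) x) * f x)"
proof -
  have [measurable]: "f \<in> borel_measurable lebesgue" using f by auto
  have sw: "(LINT y|lebesgue. of_real (indicator (cbox a b) y) * (LINT x|lebesgue. f x * gauss (of_real ((c n)\<^sup>2)) (x - y)))
     = (LINT x|lebesgue. f x * (LINT y|lebesgue. of_real (indicator (cbox a b) y) * gauss (of_real ((c n)\<^sup>2)) (x - y)))" for n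
    using integral_kernel_swap[OF f integrable_cbox gauss_kernel_measurable[of "of_real ((c n)\<^sup>2)"],
        OF cmod_gauss_le, of a b] c(1)[of n]
    by (simp del: of_real_power)
  have [measurable]: "(\<lambda>x. LINT y|lebesgue. of_real (indicator (cbox a b) y) * gauss (of_real ((c n)\<^sup>2)) (x - y)) \<in> borel_measurable lebesgue" for n
    using borel_measurable_integral_kernel[OF _ gauss_kernel_measurable[of "of_real ((c n)\<^sup>2)"], of "\<lambda>y. of_real (indicator (cbox a b) y)"]
      borel_measurable_integrable[OF integrable_cbox[of a b]] by (simp del: of_real_power)
  have "(\<lambda>n. LINT x|lebesgue. f x * (LINT y|lebesgue. of_real (indicator (cbox a b) y) * gauss (of_real ((c n)\<^sup>2)) (x - y)))
    \<longlonglongrightarrow> (LINT x|lebesgue. f x * of_real (indicator (cbox a b) x * (2 * pi) ^ DIM('a)))"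
  proof (rule integral_dominated_convergence[where w = "\<lambda>x. cmod (f x) * (2 * pi) ^ DIM('a)"])
    have "AE x in lebesgue. x \<notin> frontier (cbox a b)"
      using negligible_frontier_interval[of a b]
      by (intro AE_not_in) (auto simp: negligible_iff_null_sets frontier_def interior_cbox closure_closed)
    then show "AE x in lebesgue. (\<lambda>n. f x * (LINT y|lebesgue. of_real (indicator (cbox a b) y) * gauss (of_real ((c n)\<^sup>2)) (x - y)))
        \<longlonglongrightarrow> f x * of_real (indicator (cbox a b) x * (2 * pi) ^ DIM('a))"
      by eventually_elim (intro tendsto_mult tendsto_const cbox_gauss_convolution_tendsto c)
    show "AE x in lebesgue. norm (f x * (LINT y|lebesgue. of_real (indicator (cbox a b) y) * gauss (of_real ((c n)\<^sup>2)) (x - y)))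
        \<le> cmod (f x) * (2 * pi) ^ DIM('a)" for n
      unfolding norm_mult by (intro AE_I2 mult_left_mono norm_ge_zero cbox_gauss_convolution_bound c)
    show "(\<lambda>x. f x * (LINT y|lebesgue. of_real (indicator (cbox a b) y) * gauss (of_real ((c n)\<^sup>2)) (x - y))) \<in> borel_measurable lebesgue" for n
      by measurable
    have [measurable]: "indicat_real (cbox a b) \<in> borel_measurable lebesgue"
      by (intro borel_measurable_indicator) auto
    show "(\<lambda>x. f x * of_real (indicator (cbox a b) x * (2 * pi) ^ DIM('a))) \<in> borel_measurable lebesgue"
      by (intro borel_measurable_times borel_measurable_of_real borel_measurable_const) measurable
    show "integrable lebesgue (\<lambda>x. cmod (f x) * (2 * pi) ^ DIM('a))" using f by simp
  qed
  moreover have "(LINT x|lebesgue. f x * of_real (indicator (cbox a b) x * (2 * pi) ^ DIM('a)))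
      = of_real ((2 * pi) ^ DIM('a)) * (LINT x|lebesgue. of_real (indicator (cbox a b) x) * f x)"
    by (subst integral_mult_right_zero[symmetric]) (simp add: mult_ac)
  ultimately show ?thesis unfolding sw by simp
qed

text \<open>Lebesgue differentiation: almost every value of \<open>f\<close> is a limit of averages
  over cubes with a corner at that point, and each average is bounded by \<open>M\<close>.\<close>

lemma AE_norm_le_of_cbox:
  fixes f :: "'a::euclidean_space \<Rightarrow> complex"
  assumes f: "\<And>a b. f integrable_on cbox a b"
    and M: "\<And>a b. cmod (integral (cbox a b) f) \<le> M * measure lborel (cbox a b)"
  shows "AE x in lebesgue. cmod (f x) \<le> M"
proof -
  obtain N where N: "negligible N" and
    *: "\<And>x e. \<lbrakk>x \<notin> N; 0 < e\<rbrakk> \<Longrightarrow>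
               \<exists>d>0. \<forall>h. 0 < h \<and> h < d \<longrightarrow>
                         norm(integral (cbox x (x + h *\<^sub>R One)) f /\<^sub>R h ^ DIM('a) - f x) < e"
    using integrable_ccontinuous_explicit[OF f] by metis
  have "cmod (f x) \<le> M" if x: "x \<notin> N" for x
  proof (rule field_le_epsilon)
    fix e :: real assume "e > 0"
    then obtain d where d: "d > 0" "\<And>h. 0 < h \<Longrightarrow> h < d \<Longrightarrow> norm(integral (cbox x (x + h *\<^sub>R One)) f /\<^sub>R h ^ DIM('a) - f x) < e"
      using *[OF x] by metis
    define h where "h = d / 2"
    have h: "0 < h" "h < d" using d by (auto simp: h_def)
    have vol: "measure lborel (cbox x (x + h *\<^sub>R One)) = h ^ DIM('a)"
      using h by (subst content_cbox) (auto simp: inner_add_left)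
    have "norm (integral (cbox x (x + h *\<^sub>R One)) f /\<^sub>R h ^ DIM('a)) \<le> (M * h ^ DIM('a)) / h ^ DIM('a)"
      using M[of x "x + h *\<^sub>R One"] h unfolding vol by (simp add: divide_simps)
    then have "norm (integral (cbox x (x + h *\<^sub>R One)) f /\<^sub>R h ^ DIM('a)) \<le> M" using h by simp
    moreover have "cmod (f x) \<le> norm (integral (cbox x (x + h *\<^sub>R One)) f /\<^sub>R h ^ DIM('a)) + norm(integral (cbox x (x + h *\<^sub>R One)) f /\<^sub>R h ^ DIM('a) - f x)"
      by (metis norm_minus_commute norm_triangle_sub)
    ultimately show "cmod (f x) \<le> M + e" using d(2)[OF h] by linarith
  qed
  moreover have "AE x in lebesgue. x \<notin> N"
    using N by (intro AE_not_in) (simp add: negligible_iff_null_sets)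
  ultimately show ?thesis by (auto elim: eventually_mono)
qed

lemma integral_cbox_eq_LINT:
  fixes f :: "'a::euclidean_space \<Rightarrow> complex"
  assumes "integrable lebesgue (\<lambda>x. of_real (indicator (cbox a b) x) * f x)"
  shows "f integrable_on cbox a b" "integral (cbox a b) f = (LINT x|lebesgue. of_real (indicator (cbox a b) x) * f x)"
proof -
  have "set_integrable lebesgue (cbox a b) f"
    using assms by (simp add: set_integrable_def scaleR_conv_of_real)
  from set_lebesgue_integral_eq_integral[OF this]
  show "f integrable_on cbox a b" "integral (cbox a b) f = (LINT x|lebesgue. of_real (indicator (cbox a b) x) * f x)"
    by (simp_all add: set_lebesgue_integral_def scaleR_conv_of_real)
qed

lemma integrable_cbox_mult:
  fixes f :: "'a::euclidean_space \<Rightarrow> complex"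
  assumes f: "integrable lebesgue f"
  shows "integrable lebesgue (\<lambda>x. of_real (indicator (cbox a b) x) * f x)"
  by (rule integrable_bounded_mult[OF borel_measurable_integrable[OF integrable_cbox] _ f, of _ _ 1])
     (auto simp: indicator_def)

text \<open>The kernels \<open>gauss (of_real e)\<close> have total mass
  \<open>(2 * pi) ^ DIM('a)\<close>, whence the denominator; as \<open>e\<close> tends to 0 they
  recover the integrals of \<open>f\<close> over boxes.\<close>

lemma AE_norm_le_of_convolution:
  fixes f :: "'a::euclidean_space \<Rightarrow> complex"
  assumes f: "integrable lebesgue f"
    and M: "\<And>e y. e > 0 \<Longrightarrow> cmod (LINT x|lebesgue. f x * gauss (of_real e) (x - y)) \<le> M"
  shows "AE x in lebesgue. cmod (f x) \<le> M / (2 * pi) ^ DIM('a)"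
proof (rule AE_norm_le_of_cbox)
  note i = integral_cbox_eq_LINT[OF integrable_cbox_mult[OF f]]
  show "f integrable_on cbox a b" for a b by (rule i)
  show "cmod (integral (cbox a b) f) \<le> M / (2 * pi) ^ DIM('a) * measure lborel (cbox a b)" for a b
  proof -
    let ?c = "\<lambda>n. 1 / real (Suc n)"
    let ?J = "\<lambda>n. LINT y|lebesgue. of_real (indicator (cbox a b) y) * (LINT x|lebesgue. f x * gauss (of_real ((?c n)\<^sup>2)) (x - y))"
    have "?J \<longlonglongrightarrow> of_real ((2 * pi) ^ DIM('a)) * (LINT x|lebesgue. of_real (indicator (cbox a b) x) * f x)"
      by (rule integral_cbox_convolution_tendsto[OF f _ LIMSEQ_Suc[OF lim_1_over_n]]) auto
    then have "(\<lambda>n. cmod (?J n)) \<longlonglongrightarrow> cmod (of_real ((2 * pi) ^ DIM('a)) * (LINT x|lebesgue. of_real (indicator (cbox a b) x) * f x))"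
      by (rule tendsto_norm)
    moreover have "cmod (?J n) \<le> M * measure lborel (cbox a b)" for n
    proof -
      have "cmod (?J n) \<le> M * (LINT y|lebesgue. cmod (of_real (indicator (cbox a b) y)))"
        by (intro norm_integral_kernel_le integrable_cbox M) simp
      also have "(LINT y|lebesgue. cmod (of_real (indicator (cbox a b) y))) = measure lborel (cbox a b)"
        by simp
      finally show ?thesis .
    qed
    ultimately have "cmod (of_real ((2 * pi) ^ DIM('a)) * (LINT x|lebesgue. of_real (indicator (cbox a b) x) * f x)) \<le> M * measure lborel (cbox a b)"
      by (intro LIMSEQ_le_const2) auto
    then show ?thesis unfolding i by (simp add: norm_mult norm_power field_simps)
  qed
qed

lemma packet_ft_centred: "packet_ft e 0 0 q x = gauss (of_real e) (x - q)"
proof -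
  have "Complex e 0 = of_real e" by (simp add: complex_eq_iff)
  then show ?thesis by (simp add: packet_ft_def)
qed

lemma integral_fourier_gauss:
  fixes f :: "'a::euclidean_space \<Rightarrow> complex"
  assumes f: "integrable lebesgue f" and e: "e > 0"
  shows "(LINT x|lebesgue. f x * gauss (of_real e) (x - y)) = (LINT \<xi>|lebesgue. fourier f \<xi> * packet e 0 0 y \<xi>)"
  unfolding integral_fourier_mult[OF f integrable_packet[OF e]] fourier_packet[OF e] packet_ft_centred ..

text \<open>The Gaussian means of \<open>f\<close>, integrated over a box, are given two limits: one
  by approximation of the identity, the other by dominated convergence on the Fourier side. Their
  difference then integrates to 0 over every box, and \<open>AE_norm_le_of_cbox\<close> with bound 0
  makes it vanish almost everywhere.\<close>

lemma fourier_inversion: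
  fixes f :: "'a::euclidean_space \<Rightarrow> complex"
  assumes f: "integrable lebesgue f" and F: "integrable lebesgue (fourier f)"
  shows "AE x in lebesgue. of_real ((2 * pi) ^ DIM('a)) * f x = (LINT \<xi>|lebesgue. fourier f \<xi> * exp (\<i> * of_real (x \<bullet> \<xi>)))"
proof -
  define P where "P = complex_of_real ((2 * pi) ^ DIM('a))"
  define W where "W = (\<lambda>x. LINT \<xi>|lebesgue. fourier f \<xi> * exp (\<i> * of_real (x \<bullet> \<xi>)))"
  have [measurable]: "f \<in> borel_measurable lebesgue" "fourier f \<in> borel_measurable lebesgue" using f F by auto
  have "(\<lambda>p::'a \<times> 'a. exp (\<i> * complex_of_real (fst p \<bullet> snd p))) \<in> borel_measurable borel"
    by (intro borel_measurable_continuous_onI continuous_intros)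
  then have Wm [measurable]: "W \<in> borel_measurable lebesgue"
    unfolding W_def using borel_measurable_integral_kernel[of "fourier f" "\<lambda>p. exp (\<i> * complex_of_real (fst p \<bullet> snd p))"] by simp
  have Wb: "cmod (W x) \<le> (LINT \<xi>|lebesgue. cmod (fourier f \<xi>))" for x
    using norm_integral_kernel_le[OF F, of "\<lambda>\<xi>. exp (\<i> * of_real (x \<bullet> \<xi>))" 1] by (simp add: W_def)
  have Wi: "integrable lebesgue (\<lambda>x. of_real (indicator (cbox a b) x) * W x)" for a b
    using integrable_bounded_mult[OF Wm Wb integrable_cbox] by (simp add: mult.commute)
  have fi: "integrable lebesgue (\<lambda>x. of_real (indicator (cbox a b) x) * f x)" for a b
    by (rule integrable_cbox_mult[OF f])
  have Di: "integrable lebesgue (\<lambda>x. of_real (indicator (cbox a b) x) * (P * f x - W x))" for a b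
  proof -
    have "integrable lebesgue (\<lambda>x. P * (of_real (indicator (cbox a b) x) * f x) - of_real (indicator (cbox a b) x) * W x)"
      using fi Wi by auto
    then show ?thesis by (simp add: algebra_simps)
  qed
  note i = integral_cbox_eq_LINT[OF Di]
  have "AE x in lebesgue. cmod (P * f x - W x) \<le> 0"
  proof (rule AE_norm_le_of_cbox)
    show "(\<lambda>x. P * f x - W x) integrable_on cbox a b" for a b by (rule i)
    show "cmod (integral (cbox a b) (\<lambda>x. P * f x - W x)) \<le> 0 * measure lborel (cbox a b)" for a b
    proof -
      let ?c = "\<lambda>n. 1 / real (Suc n)"
      let ?S = "\<lambda>n y. LINT x|lebesgue. f x * gauss (of_real ((?c n)\<^sup>2)) (x - y)"
      have "(\<lambda>n. LINT y|lebesgue. of_real (indicator (cbox a b) y) * ?S n y)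
          \<longlonglongrightarrow> P * (LINT x|lebesgue. of_real (indicator (cbox a b) x) * f x)"
        unfolding P_def by (rule integral_cbox_convolution_tendsto[OF f _ LIMSEQ_Suc[OF lim_1_over_n]]) auto
      moreover have "(\<lambda>n. LINT y|lebesgue. of_real (indicator (cbox a b) y) * ?S n y)
          \<longlonglongrightarrow> (LINT y|lebesgue. of_real (indicator (cbox a b) y) * W y)"
      proof (rule integral_dominated_convergence[where w = "\<lambda>y. indicator (cbox a b) y * (LINT \<xi>|lebesgue. cmod (fourier f \<xi>))"])
        show "integrable lebesgue (\<lambda>y. indicator (cbox a b) y * (LINT \<xi>|lebesgue. cmod (fourier f \<xi>)))"
          by (intro integrable_mult_left integrable_real_indicator) (auto simp: emeasure_lborel_cbox_eq)
        have "?S n \<in> borel_measurable lebesgue" for n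
        proof -
          have "(\<lambda>p::'a \<times> 'a. gauss (of_real ((?c n)\<^sup>2)) (snd p - fst p)) \<in> borel_measurable borel"
            by (rule measurable_compose[OF _ gauss_measurable])
               (intro borel_measurable_continuous_onI continuous_intros)
          then show ?thesis
            using borel_measurable_integral_kernel[of f "\<lambda>p. gauss (of_real ((?c n)\<^sup>2)) (snd p - fst p)"] by simp
        qed
        then show "(\<lambda>y. of_real (indicator (cbox a b) y) * ?S n y) \<in> borel_measurable lebesgue" for n
          by (intro borel_measurable_times borel_measurable_integrable[OF integrable_cbox])
        show "(\<lambda>y. of_real (indicator (cbox a b) y) * W y) \<in> borel_measurable lebesgue"
          by (rule borel_measurable_integrable[OF Wi])
        \<comment> \<open>On the Fourier side the mean is the inverse Fourier integral damped by a
          Gaussian factor that tends to 1.\<close>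
        have S: "?S n y = (LINT \<xi>|lebesgue. fourier f \<xi> * packet ((?c n)\<^sup>2) 0 0 y \<xi>)" for n y
          by (rule integral_fourier_gauss[OF f]) simp
        show "AE y in lebesgue. norm (of_real (indicator (cbox a b) y) * ?S n y) \<le> indicator (cbox a b) y * (LINT \<xi>|lebesgue. cmod (fourier f \<xi>))" for n
          using norm_integral_kernel_le[OF F, of "packet ((?c n)\<^sup>2) 0 0 y" 1 for y] unfolding S
          by (intro AE_I2) (auto simp: norm_mult cmod_packet indicator_def)
        show "AE y in lebesgue. (\<lambda>n. of_real (indicator (cbox a b) y) * ?S n y) \<longlonglongrightarrow> of_real (indicator (cbox a b) y) * W y"
        proof (intro AE_I2 tendsto_mult tendsto_const)
          fix y
          show "(\<lambda>n. ?S n y) \<longlonglongrightarrow> W y" unfolding S W_def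
          proof (rule integral_dominated_convergence[where w = "\<lambda>\<xi>. cmod (fourier f \<xi>)"])
            show "AE \<xi> in lebesgue. (\<lambda>n. fourier f \<xi> * packet ((?c n)\<^sup>2) 0 0 y \<xi>) \<longlonglongrightarrow> fourier f \<xi> * exp (\<i> * of_real (y \<bullet> \<xi>))"
            proof (intro AE_I2 tendsto_mult tendsto_const)
              fix \<xi>
              have "(\<lambda>n. packet ((?c n)\<^sup>2) 0 0 y \<xi>) \<longlonglongrightarrow> exp (of_real (- (0\<^sup>2 * (norm (\<xi> - 0))\<^sup>2 / 2)) + \<i> * of_real (y \<bullet> \<xi> - 0 * (norm \<xi>)\<^sup>2 / 2))"
                unfolding packet_def by (intro tendsto_intros LIMSEQ_Suc[OF lim_1_over_n]) auto
              then show "(\<lambda>n. packet ((?c n)\<^sup>2) 0 0 y \<xi>) \<longlonglongrightarrow> exp (\<i> * of_real (y \<bullet> \<xi>))" by simp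
            qed
            have [measurable]: "(\<lambda>\<xi>. exp (\<i> * complex_of_real (y \<bullet> \<xi>))) \<in> borel_measurable lebesgue"
              by (rule measurable_lebesgue_borel) measurable
            have [measurable]: "packet ((?c n)\<^sup>2) 0 0 y \<in> borel_measurable lebesgue" for n
              by (rule measurable_lebesgue_borel) measurable
            show "(\<lambda>\<xi>. fourier f \<xi> * exp (\<i> * of_real (y \<bullet> \<xi>))) \<in> borel_measurable lebesgue"
              by measurable
            show "(\<lambda>\<xi>. fourier f \<xi> * packet ((?c n)\<^sup>2) 0 0 y \<xi>) \<in> borel_measurable lebesgue" for n
              by measurable
          qed (use F in \<open>auto simp: norm_mult cmod_packet intro!: mult_left_le\<close>)
        qed
      qed
      ultimately have eq: "P * (LINT x|lebesgue. of_real (indicator (cbox a b) x) * f x) = (LINT y|lebesgue. of_real (indicator (cbox a b) y) * W y)"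
        by (rule LIMSEQ_unique)
      have "(LINT x|lebesgue. of_real (indicator (cbox a b) x) * (P * f x - W x))
          = (LINT x|lebesgue. P * (of_real (indicator (cbox a b) x) * f x) - of_real (indicator (cbox a b) x) * W x)"
        by (simp add: algebra_simps)
      also have "\<dots> = 0" using fi Wi eq by (subst Bochner_Integration.integral_diff) auto
      finally show ?thesis unfolding i by simp
    qed
  qed
  then show ?thesis by (simp add: P_def W_def)
qed

section \<open>The Duhamel formula tested against packets\<close>

lemma L2_norm_diff_finite:
  fixes f g :: "'a::euclidean_space \<Rightarrow> complex"
  assumes "f \<in> L2_space" "g \<in> L2_space"
  shows "L2_norm (\<lambda>x. f x - g x) < \<infinity>"
proof -
  have [measurable]: "f \<in> borel_measurable lebesgue" "g \<in> borel_measurable lebesgue"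
    using assms by (auto intro: L2_space_measurable)
  have "(cmod (f x - g x))\<^sup>2 \<le> 2 * (cmod (f x))\<^sup>2 + 2 * (cmod (g x))\<^sup>2" for x
  proof -
    have "(cmod (f x - g x))\<^sup>2 \<le> (cmod (f x) + cmod (g x))\<^sup>2"
      by (intro power_mono norm_triangle_ineq4) simp
    also have "\<dots> \<le> 2 * (cmod (f x))\<^sup>2 + 2 * (cmod (g x))\<^sup>2"
      using sum_squares_bound[of "cmod (f x)" "cmod (g x)"] by (simp add: power2_sum)
    finally show ?thesis .
  qed
  then have "(L2_norm (\<lambda>x. f x - g x))\<^sup>2 \<le> (\<integral>\<^sup>+x. 2 * ennreal ((cmod (f x))\<^sup>2) + 2 * ennreal ((cmod (g x))\<^sup>2) \<partial>lebesgue)"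
    unfolding L2_norm_square
    by (intro nn_integral_mono) (simp add: ennreal_leI flip: ennreal_plus ennreal_mult' ennreal_numeral)
  also have "\<dots> = 2 * (L2_norm f)\<^sup>2 + 2 * (L2_norm g)\<^sup>2"
    unfolding L2_norm_square by (simp add: nn_integral_add nn_integral_cmult)
  also have "\<dots> < \<infinity>"
    using assms by (auto simp: L2_space_def ennreal_mult_less_top power2_eq_square)
  finally show ?thesis
    by (cases "L2_norm (\<lambda>x. f x - g x)") (auto simp: top_power_ennreal)
qed

lemma L2_simple_integral_mult:
  fixes w :: "'a::euclidean_space \<Rightarrow> complex"
  assumes s: "L2_simple M s" and w: "w \<in> L2_space"
  shows "integrable M (\<lambda>u. LINT x|lebesgue. s u x * w x)"
    and "(LINT u|M. LINT x|lebesgue. s u x * w x) = (LINT x|lebesgue. L2_simple_integral M s x * w x)"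
    and "integrable lebesgue (\<lambda>x. L2_simple_integral M s x * w x)"
proof -
  define S where "S = s ` space M"
  define E where "E = (\<lambda>f. {u \<in> space M. s u = f})"
  define J where "J = (\<lambda>f. LINT x|lebesgue. f x * w x)"
  have sf: "simple_function M s" and L2: "\<And>f. f \<in> S \<Longrightarrow> f \<in> L2_space"
    and fin: "emeasure M {u \<in> space M. s u \<noteq> (\<lambda>_. 0)} \<noteq> \<infinity>"
    using s by (auto simp: L2_simple_def S_def)
  have finS: "finite S" using sf by (simp add: S_def simple_function_def)
  have E: "E f \<in> sets M" for f
  proof (cases "f \<in> S")
    case True
    moreover have "E f = s -` {f} \<inter> space M" by (auto simp: E_def)
    ultimately show ?thesis using sf by (auto simp: simple_function_def S_def)
  next
    case False
    then have "E f = {}" by (auto simp: E_def S_def)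
    then show ?thesis by simp
  qed
  have Efin: "emeasure M (E f) < \<infinity>" if "f \<noteq> (\<lambda>_. 0)" for f
  proof -
    have "{u \<in> space M. s u \<noteq> (\<lambda>_. 0)} = space M - E (\<lambda>_. 0)" by (auto simp: E_def)
    then have "{u \<in> space M. s u \<noteq> (\<lambda>_. 0)} \<in> sets M" using E by auto
    then have "emeasure M (E f) \<le> emeasure M {u \<in> space M. s u \<noteq> (\<lambda>_. 0)}"
      using that by (intro emeasure_mono) (auto simp: E_def)
    also have "\<dots> < \<infinity>" using fin by (simp add: less_top)
    finally show ?thesis .
  qed
  have eq: "(LINT x|lebesgue. s u x * w x) = (\<Sum>f\<in>S. indicator (E f) u *\<^sub>R J f)" if "u \<in> space M" for u
  proof -
    have "(\<Sum>f\<in>S. indicator (E f) u *\<^sub>R J f) = (\<Sum>f\<in>S. if f = s u then J f else 0)"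
      using that by (intro sum.cong) (auto simp: E_def)
    also have "\<dots> = J (s u)" using that finS by (simp add: S_def)
    finally show ?thesis by (simp add: J_def)
  qed
  \<comment> \<open>Only the level set of the zero function can have infinite measure, and there the
    pairing \<open>J\<close> vanishes.\<close>
  have int1: "integrable M (\<lambda>u. indicator (E f) u *\<^sub>R J f)" for f
  proof (cases "f = (\<lambda>_. 0)")
    case False
    then show ?thesis using E Efin by (intro integrable_scaleR_left integrable_real_indicator) auto
  qed (simp add: J_def)
  have int2: "(LINT u|M. indicator (E f) u *\<^sub>R J f) = of_real (measure M (E f)) * J f" for f
  proof (cases "f = (\<lambda>_. 0)")
    case False
    then show ?thesis using E Efin by (simp add: scaleR_conv_of_real)
  qed (simp add: J_def)
  show "integrable M (\<lambda>u. LINT x|lebesgue. s u x * w x)"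
    using int1 by (subst Bochner_Integration.integrable_cong[OF refl eq]) auto
  have "(LINT u|M. LINT x|lebesgue. s u x * w x) = (\<Sum>f\<in>S. of_real (measure M (E f)) * J f)"
    by (subst Bochner_Integration.integral_cong[OF refl eq]) (simp_all add: Bochner_Integration.integral_sum int1 int2)
  moreover have i: "integrable lebesgue (\<lambda>x. of_real (measure M (E f)) * (f x * w x))" if "f \<in> S" for f
    using integrable_mult_L2[OF L2[OF that] w] by simp
  moreover have e: "L2_simple_integral M s x * w x = (\<Sum>f\<in>S. of_real (measure M (E f)) * (f x * w x))" for x
    by (simp add: L2_simple_integral_def S_def E_def sum_distrib_right mult.assoc)
  ultimately show "(LINT u|M. LINT x|lebesgue. s u x * w x) = (LINT x|lebesgue. L2_simple_integral M s x * w x)"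
    unfolding e by (subst Bochner_Integration.integral_sum) (auto simp: J_def)
  show "integrable lebesgue (\<lambda>x. L2_simple_integral M s x * w x)"
    unfolding e using i by (rule Bochner_Integration.integrable_sum)
qed

lemma L2_simple_integral_measurable:
  assumes "L2_simple M s"
  shows "L2_simple_integral M s \<in> borel_measurable lebesgue"
  unfolding L2_simple_integral_def[abs_def] using assms
  by (intro borel_measurable_sum borel_measurable_times borel_measurable_const L2_space_measurable)
     (auto simp: L2_simple_def)

text \<open>The scalar function \<open>u \<mapsto> \<integral> F u w\<close> is only shown to be measurable up to a null set,
  since \<open>M\<close> is not assumed to be complete.\<close>

lemma has_L2_integral_mult:
  fixes w :: "'a::euclidean_space \<Rightarrow> complex"
  assumes "has_L2_integral M F I" and w: "w \<in> L2_space"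
  obtains A where "integrable M A" "AE u in M. A u = (LINT x|lebesgue. F u x * w x)"
    "(LINT u|M. A u) = (LINT x|lebesgue. I x * w x)"
proof -
  obtain s where F: "\<And>u. u \<in> space M \<Longrightarrow> F u \<in> L2_space" and I: "I \<in> L2_space"
    and s: "\<And>k::nat. L2_simple M (s k)"
    and m[measurable]: "\<And>k. (\<lambda>u. L2_norm (\<lambda>x. F u x - s k u x)) \<in> borel_measurable M"
    and lim1: "(\<lambda>k. \<integral>\<^sup>+ u. L2_norm (\<lambda>x. F u x - s k u x) \<partial>M) \<longlonglongrightarrow> 0"
    and lim2: "(\<lambda>k. L2_norm (\<lambda>x. L2_simple_integral M (s k) x - I x)) \<longlonglongrightarrow> 0"
    using assms(1) unfolding has_L2_integral_def by blast
  define N where "N = (\<lambda>k u. L2_norm (\<lambda>x. F u x - s k u x))"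
  define a where "a = (\<lambda>k u. LINT x|lebesgue. s k u x * w x)"
  define A0 where "A0 = (\<lambda>u. LINT x|lebesgue. F u x * w x)"
  have sL2: "s k u \<in> L2_space" if "u \<in> space M" for k u using s[of k] that by (auto simp: L2_simple_def)
  have [measurable]: "N k \<in> borel_measurable M" for k using m by (simp add: N_def)
  have a_int: "integrable M (a k)" for k unfolding a_def by (rule L2_simple_integral_mult[OF s w])
  have [measurable]: "a k \<in> borel_measurable M" for k using a_int by auto
  have wf: "L2_norm w < \<infinity>" using w by (auto simp: L2_space_def)
  have close: "ennreal (cmod (A0 u - a k u)) \<le> N k u * L2_norm w" if "u \<in> space M" for u k
    unfolding A0_def a_def N_def
    by (intro cmod_integral_diff_le_L2 L2_space_measurable F sL2 that integrable_mult_L2 w)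
  have "\<forall>\<^sub>F k in sequentially. (\<integral>\<^sup>+u. N k u \<partial>M) < 1"
    using lim1 unfolding N_def by (auto dest: order_tendstoD(2)[of _ _ _ 1])
  \<comment> \<open>Finitely many approximants may be at infinite distance from \<open>F\<close>.
    From \<open>k0\<close> on the distances are integrable, so a subsequence of them tends to 0
    almost everywhere.\<close>
  then obtain k0 where k0: "\<And>k. k \<ge> k0 \<Longrightarrow> (\<integral>\<^sup>+u. N k u \<partial>M) < 1"
    by (auto simp: eventually_sequentially)
  have Nfin: "N k u < \<infinity>" if "u \<in> space M" for k u
    unfolding N_def by (intro L2_norm_diff_finite F sL2 that)
  define n where "n = (\<lambda>k u. enn2real (N (k + k0) u))"
  have n_eq: "ennreal (n k u) = N (k + k0) u" if "u \<in> space M" for k u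
    using Nfin[OF that] by (simp add: n_def)
  have n_nn: "(\<integral>\<^sup>+u. ennreal (norm (n k u)) \<partial>M) = (\<integral>\<^sup>+u. N (k + k0) u \<partial>M)" for k
    by (rule nn_integral_cong) (use n_eq in \<open>auto simp: n_def\<close>)
  have n_int: "integrable M (n k)" for k
  proof (rule integrableI_bounded)
    show "n k \<in> borel_measurable M" unfolding n_def by measurable
    show "(\<integral>\<^sup>+u. ennreal (norm (n k u)) \<partial>M) < \<infinity>"
      unfolding n_nn using k0[of "k + k0"] by (auto intro: less_trans)
  qed
  have "(\<lambda>k. \<integral>\<^sup>+u. N (k + k0) u \<partial>M) \<longlonglongrightarrow> 0"
    using lim1 unfolding N_def by (rule LIMSEQ_ignore_initial_segment)
  then have "(\<lambda>k. \<integral>\<^sup>+u. ennreal (norm (n k u)) \<partial>M) \<longlonglongrightarrow> 0" by (simp only: n_nn)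
  then have "(\<lambda>k. ennreal (LINT u|M. norm (n k u))) \<longlonglongrightarrow> ennreal 0"
    by (subst (asm) nn_integral_eq_integral) (auto intro!: integrable_norm n_int)
  then have "(\<lambda>k. LINT u|M. norm (n k u)) \<longlonglongrightarrow> 0"
    by (subst (asm) tendsto_ennreal_iff) auto
  from tendsto_L1_AE_subseq[OF n_int this]
  obtain r where r: "strict_mono r" "AE u in M. (\<lambda>k. n (r k) u) \<longlonglongrightarrow> 0" by blast
  \<comment> \<open>Where the sequence diverges, \<open>lim\<close> is one fixed value, so
    \<open>A\<close> is measurable on all of \<open>M\<close>; it agrees with \<open>A0\<close>
    wherever the chosen distances tend to 0.\<close>
  define A where "A = (\<lambda>u. lim (\<lambda>k. a (r k + k0) u))"
  have [measurable]: "A \<in> borel_measurable M" unfolding A_def by measurable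
  have AE: "AE u in M. A u = A0 u"
    using r(2) AE_space
  proof eventually_elim
    case (elim u)
    have "(\<lambda>k. cmod (a (r k + k0) u - A0 u)) \<longlonglongrightarrow> 0"
    proof (rule tendsto_sandwich[where f = "\<lambda>_. 0" and h = "\<lambda>k. n (r k) u * enn2real (L2_norm w)"])
      show "\<forall>\<^sub>F k in sequentially. cmod (a (r k + k0) u - A0 u) \<le> n (r k) u * enn2real (L2_norm w)"
      proof (intro always_eventually allI)
        fix k
        have "ennreal (cmod (A0 u - a (r k + k0) u)) \<le> ennreal (n (r k) u) * ennreal (enn2real (L2_norm w))"
          using close[OF elim(2), of "r k + k0"] wf by (simp add: n_eq[OF elim(2)])
        then show "cmod (a (r k + k0) u - A0 u) \<le> n (r k) u * enn2real (L2_norm w)"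
          by (simp add: n_def norm_minus_commute flip: ennreal_mult)
      qed
      show "(\<lambda>k. n (r k) u * enn2real (L2_norm w)) \<longlonglongrightarrow> 0"
        using tendsto_mult_right[OF elim(1), of "enn2real (L2_norm w)"] by simp
    qed auto
    then have "(\<lambda>k. a (r k + k0) u) \<longlonglongrightarrow> A0 u"
      by (rule LIM_zero_cancel[OF tendsto_norm_zero_cancel])
    then show "A u = A0 u" unfolding A_def by (rule limI)
  qed
  have close': "(\<integral>\<^sup>+u. ennreal (cmod (A u - a k u)) \<partial>M) \<le> (\<integral>\<^sup>+u. N k u \<partial>M) * L2_norm w" for k
  proof -
    have "(\<integral>\<^sup>+u. ennreal (cmod (A u - a k u)) \<partial>M) \<le> (\<integral>\<^sup>+u. N k u * L2_norm w \<partial>M)"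
      by (rule nn_integral_mono_AE) (use AE AE_space in eventually_elim, use close in auto)
    then show ?thesis by (simp add: nn_integral_multc)
  qed
  have "integrable M (\<lambda>u. A u - a k0 u)"
  proof (rule integrableI_bounded)
    have "(\<integral>\<^sup>+u. ennreal (cmod (A u - a k0 u)) \<partial>M) \<le> 1 * L2_norm w"
      by (rule order_trans[OF close'[of k0] mult_right_mono]) (use k0[of k0] in simp_all)
    also have "\<dots> < \<infinity>" using wf by simp
    finally show "(\<integral>\<^sup>+u. ennreal (cmod (A u - a k0 u)) \<partial>M) < \<infinity>" .
  qed measurable
  then have A_int: "integrable M A"
    using Bochner_Integration.integrable_add[OF _ a_int[of k0], of "\<lambda>u. A u - a k0 u"] by simp
  have "(\<lambda>k. LINT u|M. a k u) \<longlonglongrightarrow> (LINT u|M. A u)"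
  proof (rule tendsto_L1_int[OF a_int A_int])
    have "(\<lambda>k. (\<integral>\<^sup>+u. N k u \<partial>M) * L2_norm w) \<longlonglongrightarrow> 0 * L2_norm w"
      using wf lim1 unfolding N_def by (intro tendsto_mult_ennreal tendsto_const) auto
    then have l: "(\<lambda>k. (\<integral>\<^sup>+u. N k u \<partial>M) * L2_norm w) \<longlonglongrightarrow> 0" by simp
    show "(\<lambda>k. \<integral>\<^sup>+u. ennreal (norm (a k u - A u)) \<partial>M) \<longlonglongrightarrow> 0"
      by (rule tendsto_sandwich[OF _ _ tendsto_const l])
         (use close' in \<open>auto simp: norm_minus_commute\<close>)
  qed
  moreover have "(\<lambda>k. LINT u|M. a k u) \<longlonglongrightarrow> (LINT x|lebesgue. I x * w x)"
    unfolding a_def L2_simple_integral_mult(2)[OF s w]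
    by (intro tendsto_integral_mult_L2 L2_simple_integral_measurable s L2_space_measurable I w
        L2_simple_integral_mult(3)[OF s w] integrable_mult_L2 lim2)
  ultimately have "(LINT u|M. A u) = (LINT x|lebesgue. I x * w x)"
    by (rule LIMSEQ_unique)
  with A_int AE show ?thesis unfolding A0_def by (rule that)
qed

lemma free_evolution_L2: "free_evolution t f g \<Longrightarrow> f \<in> L2_space \<and> g \<in> L2_space"
  unfolding free_evolution_def L2_fourier_def by blast

text \<open>The packet is taken at time parameter \<open>t - s\<close>, which the propagators over
  the times \<open>s\<close> and \<open>s - \<tau>\<close> raise to \<open>t\<close> and
  \<open>t - \<tau>\<close>. On the right-hand side \<open>s\<close> then survives only in the
  domain of integration, and the equations for different \<open>s\<close> can be subtracted.\<close>

lemma duhamel_packet: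
  fixes V :: "real \<Rightarrow> 'a::euclidean_space \<Rightarrow> complex"
  assumes sol: "schroedinger_solution V \<psi>0 \<psi>" and e: "e > 0" and s: "0 \<le> s"
  shows "\<exists>c. ((\<lambda>\<tau>. LINT x|lebesgue. V \<tau> x * \<psi> \<tau> x * packet_ft e (t - \<tau>) p q x) has_integral c) {0..s}
    \<and> (LINT x|lebesgue. \<psi> s x * packet_ft e (t - s) p q x) = (LINT x|lebesgue. \<psi>0 x * packet_ft e t p q x) - \<i> * c"
proof -
  let ?w = "packet_ft e (t - s) p q"
  obtain G F I where G: "free_evolution s \<psi>0 G"
    and F: "\<And>\<tau>. \<tau> \<in> {0..s} \<Longrightarrow> free_evolution (s - \<tau>) (\<lambda>x. V \<tau> x * \<psi> \<tau> x) (F \<tau>)"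
    and I: "has_L2_integral (lebesgue_on {0..s}) F I"
    and eq: "AE x in lebesgue. \<psi> s x = G x - \<i> * I x"
    using sol s unfolding schroedinger_solution_def by blast
  have w: "?w \<in> L2_space" by (rule packet_ft_L2[OF e])
  have GI: "G \<in> L2_space" "I \<in> L2_space" "\<psi> s \<in> L2_space"
    using free_evolution_L2[OF G] I sol s by (auto simp: has_L2_integral_def schroedinger_solution_def)
  obtain A where A: "integrable (lebesgue_on {0..s}) A"
      "AE u in lebesgue_on {0..s}. A u = (LINT x|lebesgue. F u x * ?w x)"
      "(LINT u|lebesgue_on {0..s}. A u) = (LINT x|lebesgue. I x * ?w x)"
    by (rule has_L2_integral_mult[OF I w])
  have A': "(A has_integral (LINT x|lebesgue. I x * ?w x)) {0..s}"
    using has_integral_integral_lebesgue_on[OF A(1)] A(3) by simp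
  obtain Z where Z: "negligible Z" "\<And>u. u \<in> {0..s} - Z \<Longrightarrow> A u = (LINT x|lebesgue. F u x * ?w x)"
  proof -
    have "AE u in lebesgue. u \<in> {0..s} \<longrightarrow> A u = (LINT x|lebesgue. F u x * ?w x)"
      using A(2) by (subst (asm) AE_restrict_space_iff) auto
    then obtain Z where "Z \<in> null_sets lebesgue" "{u \<in> space lebesgue. \<not> (u \<in> {0..s} \<longrightarrow> A u = (LINT x|lebesgue. F u x * ?w x))} \<subseteq> Z"
      unfolding eventually_ae_filter by blast
    then show ?thesis using that[of Z] by (auto simp: negligible_iff_null_sets)
  qed
  have Fu: "(LINT x|lebesgue. F u x * ?w x) = (LINT x|lebesgue. V u x * \<psi> u x * packet_ft e (t - u) p q x)" if "u \<in> {0..s}" for u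
    using free_evolution_packet[OF F[OF that] e, of "t - s" p q] by simp
  have "((\<lambda>\<tau>. LINT x|lebesgue. V \<tau> x * \<psi> \<tau> x * packet_ft e (t - \<tau>) p q x) has_integral (LINT x|lebesgue. I x * ?w x)) {0..s}"
    by (rule has_integral_spike[OF Z(1) _ A']) (use Z(2) Fu in auto)
  moreover have "(LINT x|lebesgue. \<psi> s x * ?w x) = (LINT x|lebesgue. \<psi>0 x * packet_ft e t p q x) - \<i> * (LINT x|lebesgue. I x * ?w x)"
  proof -
    have "(LINT x|lebesgue. \<psi> s x * ?w x) = (LINT x|lebesgue. G x * ?w x - \<i> * (I x * ?w x))"
    proof (rule integral_cong_AE)
      have [measurable]: "\<psi> s \<in> borel_measurable lebesgue" "G \<in> borel_measurable lebesgue" "I \<in> borel_measurable lebesgue"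
          "?w \<in> borel_measurable lebesgue"
        using GI w by (auto intro: L2_space_measurable)
      show "(\<lambda>x. \<psi> s x * ?w x) \<in> borel_measurable lebesgue" "(\<lambda>x. G x * ?w x - \<i> * (I x * ?w x)) \<in> borel_measurable lebesgue"
        by measurable
      show "AE x in lebesgue. \<psi> s x * ?w x = G x * ?w x - \<i> * (I x * ?w x)"
        using eq by eventually_elim (simp add: left_diff_distrib)
    qed
    also have "\<dots> = (LINT x|lebesgue. G x * ?w x) - \<i> * (LINT x|lebesgue. I x * ?w x)"
      using GI w by (simp add: integrable_mult_L2)
    also have "(LINT x|lebesgue. G x * ?w x) = (LINT x|lebesgue. \<psi>0 x * packet_ft e t p q x)"
      using free_evolution_packet[OF G e, of "t - s" p q] by simp
    finally show ?thesis .
  qed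
  ultimately show ?thesis by blast
qed

section \<open>Bounds for the interaction term\<close>

text \<open>Fourier inversion decomposes \<open>V\<close> into characters, and by
  \<open>packet_ft_modulate\<close> each of them sends the packet to another one with the same
  \<open>e\<close> and \<open>s\<close>, up to a phase. As all frequencies occur, \<open>m\<close>
  has to bound the pairings for every \<open>p\<close> and \<open>q\<close>.\<close>

lemma potential_packet_bound:
  fixes V :: "'a::euclidean_space \<Rightarrow> complex"
  assumes V: "integrable lebesgue V" and V': "integrable lebesgue (fourier V)"
    and \<psi>: "\<psi> \<in> L2_space" and e: "e > 0"
    and m: "\<And>p q. cmod (LINT x|lebesgue. \<psi> x * packet_ft e s p q x) \<le> m"
  shows "cmod (LINT x|lebesgue. V x * \<psi> x * packet_ft e s p q x) \<le> (LINT \<xi>|lebesgue. cmod (fourier V \<xi>)) / (2 * pi) ^ DIM('a) * m"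
proof -
  define h where "h = (\<lambda>x. \<psi> x * packet_ft e s p q x)"
  define P where "P = complex_of_real ((2 * pi) ^ DIM('a))"
  have h: "integrable lebesgue h" unfolding h_def by (intro integrable_mult_L2 \<psi> packet_ft_L2 e)
  have [measurable]: "h \<in> borel_measurable lebesgue" "V \<in> borel_measurable lebesgue" "fourier V \<in> borel_measurable lebesgue"
    using h V V' by auto
  have k: "(\<lambda>p::'a \<times> 'a. exp (\<i> * complex_of_real (fst p \<bullet> snd p))) \<in> borel_measurable borel"
    by (intro borel_measurable_continuous_onI continuous_intros)
  have "P * (LINT x|lebesgue. V x * h x) = (LINT x|lebesgue. h x * (P * V x))"
    by (subst integral_mult_right_zero[symmetric]) (simp add: mult_ac)
  also have "\<dots> = (LINT x|lebesgue. h x * (LINT \<xi>|lebesgue. fourier V \<xi> * exp (\<i> * of_real (x \<bullet> \<xi>))))"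
  proof (rule integral_cong_AE)
    show "AE x in lebesgue. h x * (P * V x) = h x * (LINT \<xi>|lebesgue. fourier V \<xi> * exp (\<i> * of_real (x \<bullet> \<xi>)))"
      using fourier_inversion[OF V V'] by eventually_elim (simp only: P_def)
    show "(\<lambda>x. h x * (LINT \<xi>|lebesgue. fourier V \<xi> * exp (\<i> * of_real (x \<bullet> \<xi>)))) \<in> borel_measurable lebesgue"
      using borel_measurable_integral_kernel[OF _ k, of "fourier V"] by simp
  qed measurable
  also have "\<dots> = (LINT \<xi>|lebesgue. fourier V \<xi> * (LINT x|lebesgue. h x * exp (\<i> * of_real (x \<bullet> \<xi>))))"
    using integral_kernel_swap[OF h V' k, of 1] by simp
  finally have eq: "P * (LINT x|lebesgue. V x * h x) = \<dots>" .
  have inner: "cmod (LINT x|lebesgue. h x * exp (\<i> * of_real (x \<bullet> \<xi>))) \<le> m" for \<xi>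
  proof -
    define c where "c = q \<bullet> p - s * (norm p)\<^sup>2 / 2 - (q - s *\<^sub>R \<xi>) \<bullet> (p - \<xi>) + s * (norm (p - \<xi>))\<^sup>2 / 2"
    have "(LINT x|lebesgue. h x * exp (\<i> * of_real (x \<bullet> \<xi>)))
        = (LINT x|lebesgue. exp (\<i> * of_real c) * (\<psi> x * packet_ft e s (p - \<xi>) (q - s *\<^sub>R \<xi>) x))"
      using packet_ft_modulate[of _ \<xi> e s p q]
      by (intro Bochner_Integration.integral_cong refl) (simp add: h_def c_def mult_ac)
    also have "\<dots> = exp (\<i> * of_real c) * (LINT x|lebesgue. \<psi> x * packet_ft e s (p - \<xi>) (q - s *\<^sub>R \<xi>) x)"
      by (rule integral_mult_right_zero)
    finally show ?thesis using m by (simp add: norm_mult)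
  qed
  have "(2 * pi) ^ DIM('a) * cmod (LINT x|lebesgue. V x * h x) = cmod (P * (LINT x|lebesgue. V x * h x))"
    by (simp add: P_def norm_mult norm_power)
  also have "\<dots> \<le> m * (LINT \<xi>|lebesgue. cmod (fourier V \<xi>))"
    unfolding eq by (rule norm_integral_kernel_le[OF V' inner])
  finally show ?thesis by (simp add: h_def field_simps)
qed

lemma ennreal_le_mult_Inf:
  fixes a c :: ennreal
  assumes "\<And>x. x \<in> S \<Longrightarrow> a \<le> c * x" and c: "c < \<infinity>" and ne: "S \<noteq> {}"
  shows "a \<le> c * Inf S"
proof (cases "c = 0")
  \<comment> \<open>Here nonemptiness of \<open>S\<close> counts: the infimum of the empty set is
    infinite, but \<open>0 * \<infinity> = 0\<close>.\<close>
  case True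
  then show ?thesis using assms(1) ne by auto
next
  case False
  have "a / c \<le> Inf S"
  proof (rule Inf_greatest)
    fix x assume "x \<in> S"
    then show "a / c \<le> x"
      using assms(1)[of x] c False by (intro divide_le_posI_ennreal) (auto simp: mult.commute zero_less_iff_neq_zero)
  qed
  then have "c * (a / c) \<le> c * Inf S" by (rule mult_left_mono) simp
  moreover have "c * (a / c) = a"
    using c False by (simp add: ennreal_times_divide ennreal_mult_divide_eq mult.commute[of c a])
  ultimately show ?thesis by simp
qed

text \<open>For each splitting of \<open>\<psi>\<close>, the square integrable part is paired with
  the \<open>L2\<close> norm of \<open>V\<close> and the bounded part with its \<open>L1\<close>
  norm; the infimum over all splittings is taken last.\<close>

lemma L1_norm_mult_le:
  fixes V \<psi> :: "'a::euclidean_space \<Rightarrow> complex"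
  assumes V[measurable]: "V \<in> borel_measurable lebesgue" and \<psi>[measurable]: "\<psi> \<in> borel_measurable lebesgue"
    and fin: "L1_cap_L2_norm V < \<infinity>"
  shows "L1_norm (\<lambda>x. V x * \<psi> x) \<le> L1_cap_L2_norm V * L2_plus_Linf_norm \<psi>"
  unfolding L2_plus_Linf_norm_def
proof (rule ennreal_le_mult_Inf[OF _ fin])
  have "L2_norm \<psi> + Linf_norm (\<lambda>_::'a. 0) \<in> {L2_norm h + Linf_norm g |h g. h \<in> borel_measurable lebesgue \<and> g \<in> borel_measurable lebesgue \<and> (AE x in lebesgue. \<psi> x = h x + g x)}"
    by (rule CollectI, rule exI[of _ \<psi>], rule exI[of _ "\<lambda>_. 0"]) simp
  then show "{L2_norm h + Linf_norm g |h g. h \<in> borel_measurable lebesgue \<and> g \<in> borel_measurable lebesgue \<and> (AE x in lebesgue. \<psi> x = h x + g x)} \<noteq> {}"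
    by blast
next
  fix z assume "z \<in> {L2_norm h + Linf_norm g |h g. h \<in> borel_measurable lebesgue \<and> g \<in> borel_measurable lebesgue \<and> (AE x in lebesgue. \<psi> x = h x + g x)}"
  then obtain h g where z: "z = L2_norm h + Linf_norm g" and [measurable]: "h \<in> borel_measurable lebesgue" "g \<in> borel_measurable lebesgue"
    and ae: "AE x in lebesgue. \<psi> x = h x + g x" by blast
  have "L1_norm (\<lambda>x. V x * \<psi> x) \<le> (\<integral>\<^sup>+x. ennreal (cmod (V x * h x)) + ennreal (cmod (V x)) * Linf_norm g \<partial>lebesgue)"
    unfolding L1_norm_def
  proof (rule nn_integral_mono_AE)
    have "AE x in lebesgue. ennreal (cmod (g x)) \<le> Linf_norm g"
      unfolding Linf_norm_def by (rule esssup_AE)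
    with ae show "AE x in lebesgue. ennreal (cmod (V x * \<psi> x)) \<le> ennreal (cmod (V x * h x)) + ennreal (cmod (V x)) * Linf_norm g"
    proof eventually_elim
      case (elim x)
      have "ennreal (cmod (V x * \<psi> x)) \<le> ennreal (cmod (V x * h x) + cmod (V x * g x))"
        unfolding elim(1) distrib_left by (intro ennreal_leI norm_triangle_ineq)
      also have "\<dots> = ennreal (cmod (V x * h x)) + ennreal (cmod (V x)) * ennreal (cmod (g x))"
        by (simp add: norm_mult ennreal_mult)
      also have "\<dots> \<le> ennreal (cmod (V x * h x)) + ennreal (cmod (V x)) * Linf_norm g"
        by (intro add_left_mono mult_left_mono elim) auto
      finally show ?case .
    qed
  qed
  also have "\<dots> = L1_norm (\<lambda>x. V x * h x) + L1_norm V * Linf_norm g"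
    unfolding L1_norm_def by (simp add: nn_integral_add nn_integral_multc)
  also have "\<dots> \<le> L2_norm V * L2_norm h + L1_norm V * Linf_norm g"
    by (intro add_right_mono L2_norm_mult_bound) auto
  also have "\<dots> \<le> (L1_norm V + L2_norm V) * L2_norm h + (L1_norm V + L2_norm V) * Linf_norm g"
    by (intro add_mono mult_right_mono) auto
  also have "\<dots> = L1_cap_L2_norm V * z" by (simp add: z L1_cap_L2_norm_def distrib_left)
  finally show "L1_norm (\<lambda>x. V x * \<psi> x) \<le> L1_cap_L2_norm V * z" .
qed

lemma cmod_integral_mult_bounded:
  fixes f g :: "'a::euclidean_space \<Rightarrow> complex"
  assumes K: "\<And>x. cmod (g x) \<le> K" "0 \<le> K" and f: "f \<in> borel_measurable lebesgue"
  shows "ennreal (cmod (LINT x|lebesgue. f x * g x)) \<le> ennreal K * L1_norm f"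
proof -
  have [measurable]: "f \<in> borel_measurable lebesgue" by fact
  have "ennreal (cmod (LINT x|lebesgue. f x * g x)) \<le> L1_norm (\<lambda>x. f x * g x)"
    by (rule cmod_integral_le_L1_norm)
  also have "\<dots> \<le> (\<integral>\<^sup>+x. ennreal K * ennreal (cmod (f x)) \<partial>lebesgue)"
    unfolding L1_norm_def
  proof (rule nn_integral_mono)
    fix x
    have "cmod (f x * g x) \<le> K * cmod (f x)"
      using mult_right_mono[OF K(1), of "cmod (f x)" x] by (simp add: norm_mult mult.commute)
    then show "ennreal (cmod (f x * g x)) \<le> ennreal K * ennreal (cmod (f x))"
      using K(2) by (simp add: ennreal_leI flip: ennreal_mult)
  qed
  also have "\<dots> = ennreal K * L1_norm f"
    unfolding L1_norm_def by (rule nn_integral_cmult) measurable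
  finally show ?thesis .
qed

section \<open>Time decay\<close>

lemma sqrt_power_eq_powr:
  assumes "s > 0"
  shows "sqrt (2 * pi / s) ^ d = sqrt (2 * pi) ^ d * s powr (- real d / 2)"
proof -
  have 1: "s powr (- real d / 2) = 1 / s powr (real d / 2)"
    by (metis minus_divide_left powr_minus_divide)
  have "s powr (real d / 2) = (s powr (1 / 2)) powr real d"
    by (simp add: powr_powr)
  also have "\<dots> = sqrt s ^ d"
    using assms by (simp add: powr_half_sqrt powr_realpow)
  finally show ?thesis
    unfolding 1 by (simp add: real_sqrt_divide power_divide)
qed

text \<open>One of \<open>t - \<tau>\<close> and \<open>\<tau>\<close> is at least
  \<open>t / 2\<close> and yields the factor \<open>(t / 2) powr (- a)\<close>. The other base is at
  least 1, so its exponent may be weakened to \<open>3 / 2\<close>, which is still integrable at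
  infinity and no longer depends on the dimension. The constant \<open>2 powr (3/2)\<close> comes
  from \<open>sqrt (1 + \<tau>\<^sup>2) \<ge> (1 + \<tau>) / 2\<close>.\<close>

lemma decay_convolution_pointwise:
  fixes t \<tau> a :: real
  assumes t: "t \<ge> 1" and a: "a \<ge> 3 / 2" and \<tau>: "0 \<le> \<tau>" "\<tau> \<le> t - 1"
  shows "(t - \<tau>) powr (- a) * sqrt (1 + \<tau>\<^sup>2) powr (- a)
    \<le> (t / 2) powr (- a) * ((t - \<tau>) powr (- (3/2)) + 2 powr (3/2) * (1 + \<tau>) powr (- (3/2)))"
proof -
  let ?r = "sqrt (1 + \<tau>\<^sup>2)"
  have r1: "?r \<ge> 1" by simp
  have r2: "?r \<ge> (1 + \<tau>) / 2"
    by (rule real_le_rsqrt) (use \<tau> zero_le_power2[of "1 - \<tau>"] in \<open>simp add: power2_eq_square algebra_simps divide_simps\<close>)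
  show ?thesis
  proof (cases "\<tau> \<le> t / 2")
    case True
    have "(t - \<tau>) powr (- a) \<le> (t / 2) powr (- a)"
      using True t a by (intro powr_mono2') auto
    moreover have "?r powr (- a) \<le> 2 powr (3/2) * (1 + \<tau>) powr (- (3/2))"
    proof -
      have "?r powr (- a) \<le> ?r powr (- (3/2))" using r1 a by (intro powr_mono) auto
      also have "\<dots> \<le> ((1 + \<tau>) / 2) powr (- (3/2))" using r2 \<tau> by (intro powr_mono2') auto
      also have "\<dots> = 2 powr (3/2) * (1 + \<tau>) powr (- (3/2))"
        using \<tau> powr_minus_divide[of "2::real" "3/2"] by (simp only: powr_divide) simp
      finally show ?thesis .
    qed
    ultimately have "(t - \<tau>) powr (- a) * ?r powr (- a) \<le> (t / 2) powr (- a) * (2 powr (3/2) * (1 + \<tau>) powr (- (3/2)))"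
      by (intro mult_mono) auto
    also have "\<dots> \<le> (t / 2) powr (- a) * ((t - \<tau>) powr (- (3/2)) + 2 powr (3/2) * (1 + \<tau>) powr (- (3/2)))"
      by (intro mult_left_mono) auto
    finally show ?thesis .
  next
    case False
    have "\<tau> \<le> ?r" by (rule real_le_rsqrt) simp
    with False have "?r powr (- a) \<le> (t / 2) powr (- a)"
      using t a by (intro powr_mono2') auto
    moreover have "(t - \<tau>) powr (- a) \<le> (t - \<tau>) powr (- (3/2))"
      using \<tau> a by (intro powr_mono) auto
    ultimately have "(t - \<tau>) powr (- a) * ?r powr (- a) \<le> (t - \<tau>) powr (- (3/2)) * (t / 2) powr (- a)"
      by (intro mult_mono) auto
    also have "\<dots> \<le> (t / 2) powr (- a) * ((t - \<tau>) powr (- (3/2)) + 2 powr (3/2) * (1 + \<tau>) powr (- (3/2)))"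
      by (subst mult.commute) (intro mult_left_mono, auto)
    finally show ?thesis .
  qed
qed

lemma decay_convolution_integral:
  fixes t :: real
  assumes t: "t \<ge> 1"
  shows "\<exists>J. ((\<lambda>\<tau>. (t - \<tau>) powr (- (3/2)) + 2 powr (3/2) * (1 + \<tau>) powr (- (3/2))) has_integral J) {0..t - 1}
    \<and> J \<le> 2 + 2 powr (3/2) * 2"
proof (intro exI conjI)
  let ?H = "\<lambda>\<tau>. 2 * (t - \<tau>) powr (- (1/2)) + 2 powr (3/2) * (- 2 * (1 + \<tau>) powr (- (1/2)))"
  show "((\<lambda>\<tau>. (t - \<tau>) powr (- (3/2)) + 2 powr (3/2) * (1 + \<tau>) powr (- (3/2))) has_integral (?H (t - 1) - ?H 0)) {0..t - 1}"
  proof (rule fundamental_theorem_of_calculus)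
    fix \<tau> assume "\<tau> \<in> {0..t - 1}"
    then have *: "t - \<tau> > 0" "1 + \<tau> > 0" by auto
    have d: "((\<lambda>z. z powr (- (1/2))) has_real_derivative - (1/2) * z powr (- (3/2))) (at z)" if "z > 0" for z :: real
      using has_real_derivative_powr[OF that, of "- (1/2)"] by simp
    have 1: "((\<lambda>\<tau>. (t - \<tau>) powr (- (1/2))) has_real_derivative - (1/2) * (t - \<tau>) powr (- (3/2)) * (- 1)) (at \<tau> within {0..t - 1})"
      by (rule DERIV_chain2[OF d]) (use * in \<open>auto intro!: derivative_eq_intros\<close>)
    have 2: "((\<lambda>\<tau>. (1 + \<tau>) powr (- (1/2))) has_real_derivative - (1/2) * (1 + \<tau>) powr (- (3/2)) * 1) (at \<tau> within {0..t - 1})"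
      by (rule DERIV_chain2[OF d]) (use * in \<open>auto intro!: derivative_eq_intros\<close>)
    have "(?H has_real_derivative (t - \<tau>) powr (- (3/2)) + 2 powr (3/2) * (1 + \<tau>) powr (- (3/2))) (at \<tau> within {0..t - 1})"
      by (rule DERIV_cong[OF DERIV_add[OF DERIV_cmult[OF 1] DERIV_cmult[OF DERIV_cmult[OF 2]]]]) simp
    then show "(?H has_vector_derivative (t - \<tau>) powr (- (3/2)) + 2 powr (3/2) * (1 + \<tau>) powr (- (3/2))) (at \<tau> within {0..t - 1})"
      by (simp add: has_real_derivative_iff_has_vector_derivative)
  qed (use t in auto)
  \<comment> \<open>At either end point one of the bases \<open>t - \<tau>\<close> and
    \<open>1 + \<tau>\<close> equals 1 and the other equals \<open>t\<close>. With
    \<open>u = t powr (- (1/2))\<close> and \<open>v = 2 powr (3/2)\<close> the left-hand side is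
    the increment of \<open>?H\<close>.\<close>
  have "2 * 1 + v * (- 2 * u) - (2 * u + v * (- 2 * 1)) \<le> 2 + v * 2" if "0 \<le> u" "0 \<le> v" for u v :: real
    using that by (simp add: algebra_simps)
  from this[of "t powr (- (1/2))" "2 powr (3/2)"]
  show "?H (t - 1) - ?H 0 \<le> 2 + 2 powr (3/2) * 2"
    by (simp only: diff_diff_eq2 diff_add_cancel add_diff_cancel_left' add_0_right diff_zero powr_one_eq_one powr_ge_zero
        add.commute[of 1 "t - 1"])
qed

text \<open>The size of the bound \<open>K\<close> is irrelevant: after \<open>k\<close> iterations it enters only through \<open>K\<close> times the
  \<open>k\<close>-th term of an exponential series.\<close>

lemma gronwall_family:
  fixes a b :: "real \<Rightarrow> 'i \<Rightarrow> complex"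
  assumes eq: "\<And>s i. r \<le> s \<Longrightarrow> s \<le> t \<Longrightarrow> ((\<lambda>\<tau>. b \<tau> i) has_integral c s i) {r..s} \<and> a s i = a r i - \<i> * c s i"
    and b: "\<And>\<tau> m i. r \<le> \<tau> \<Longrightarrow> \<tau> \<le> t \<Longrightarrow> (\<And>j. cmod (a \<tau> j) \<le> m) \<Longrightarrow> cmod (b \<tau> i) \<le> \<beta> * m"
    and M: "\<And>i. cmod (a r i) \<le> M" and K: "\<And>s i. r \<le> s \<Longrightarrow> s \<le> t \<Longrightarrow> cmod (a s i) \<le> K"
    and "r \<le> t" and "0 \<le> \<beta>"
  shows "cmod (a t i) \<le> M * exp (\<beta> * (t - r))"
proof -
  have M0: "0 \<le> M" using M[of undefined] norm_ge_zero order_trans by blast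
  \<comment> \<open>The majorants are explicit functions of \<open>s\<close>, uniform in the index;
    integrating them avoids the supremum over the family, whose measurability in time would be in
    question.\<close>
  have step: "cmod (a s i) \<le> M * exp (\<beta> * (s - r)) + K * (\<beta> * (s - r)) ^ k / fact k" if "r \<le> s" "s \<le> t" for s i k
    using that
  proof (induction k arbitrary: s i)
    case 0
    have "0 \<le> M * exp (\<beta> * (s - r))" using M0 by simp
    with K[OF 0] show ?case by (simp add: add_increasing)
  next
    case (Suc k)
    let ?g = "\<lambda>\<tau>. \<beta> * (M * exp (\<beta> * (\<tau> - r)) + K * (\<beta> * (\<tau> - r)) ^ k / fact k)"
    \<comment> \<open>Both an antiderivative of \<open>?g\<close> and the bound claimed at
      \<open>Suc k\<close>. Since \<open>?H r = M\<close>, the lower end point of the integral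
      cancels against the bound on the initial value.\<close>
    let ?H = "\<lambda>\<tau>. M * exp (\<beta> * (\<tau> - r)) + K * (\<beta> * (\<tau> - r)) ^ Suc k / fact (Suc k)"
    have g: "(?g has_integral (?H s - ?H r)) {r..s}"
    proof (rule fundamental_theorem_of_calculus)
      fix \<tau>
      have 1: "((\<lambda>\<tau>. exp (\<beta> * (\<tau> - r))) has_real_derivative exp (\<beta> * (\<tau> - r)) * \<beta>) (at \<tau> within {r..s})"
        by (auto intro!: derivative_eq_intros)
      have 2: "((\<lambda>\<tau>. (\<beta> * (\<tau> - r)) ^ Suc k) has_real_derivative real (Suc k) * (\<beta> * (\<tau> - r)) ^ k * \<beta>) (at \<tau> within {r..s})"
        by (rule DERIV_cong, rule DERIV_power) (auto intro!: derivative_eq_intros)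
      have "K * (real (Suc k) * (\<beta> * (\<tau> - r)) ^ k * \<beta>) / fact (Suc k) = \<beta> * (K * (\<beta> * (\<tau> - r)) ^ k / fact k)"
        unfolding fact_Suc by (simp add: divide_simps)
      then have "(?H has_real_derivative ?g \<tau>) (at \<tau> within {r..s})"
        by (intro DERIV_cong[OF DERIV_add[OF DERIV_cmult[OF 1] DERIV_cdivide[OF DERIV_cmult[OF 2]]]]) (simp only: distrib_left mult_ac)
      then show "(?H has_vector_derivative ?g \<tau>) (at \<tau> within {r..s})"
        by (simp add: has_real_derivative_iff_has_vector_derivative)
    qed (use Suc in auto)
    have i: "((\<lambda>\<tau>. b \<tau> i) has_integral c s i) {r..s}" and as: "a s i = a r i - \<i> * c s i"
      using eq[OF Suc.prems] by auto
    have "norm (integral {r..s} (\<lambda>\<tau>. b \<tau> i)) \<le> integral {r..s} ?g"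
    proof (rule integral_norm_bound_integral)
      show "norm (b \<tau> i) \<le> ?g \<tau>" if "\<tau> \<in> {r..s}" for \<tau>
        using that Suc by (intro b) auto
    qed (use i g in \<open>auto simp: has_integral_integrable\<close>)
    then have "cmod (c s i) \<le> ?H s - ?H r" unfolding integral_unique[OF i] integral_unique[OF g] .
    moreover have "cmod (a s i) \<le> cmod (a r i) + cmod (c s i)"
      unfolding as by (rule order_trans[OF norm_triangle_ineq4]) (simp add: norm_mult)
    ultimately show ?case using M[of i] by simp
  qed
  have "(\<lambda>k. (\<beta> * (t - r)) ^ k / fact k) \<longlonglongrightarrow> 0"
    using summable_LIMSEQ_zero[OF summable_exp[of "\<beta> * (t - r)"]] by (simp add: field_simps)
  then have "(\<lambda>k. M * exp (\<beta> * (t - r)) + K * ((\<beta> * (t - r)) ^ k / fact k)) \<longlonglongrightarrow> M * exp (\<beta> * (t - r)) + K * 0"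
    by (intro tendsto_intros)
  then show ?thesis
    using step[OF \<open>r \<le> t\<close> order_refl] by (intro LIMSEQ_le_const[of _ "M * exp (\<beta> * (t - r))"]) auto
qed

text \<open>Provides the a priori bound of \<open>gronwall_family\<close>. By Cauchy-Schwarz the
  pairing is controlled by two \<open>L2\<close> norms: that of the packet depends only on
  \<open>e\<close> and the dimension, and that of \<open>\<psi> s\<close> is locally bounded by
  continuity. Bisection makes the bound global on the compact interval.\<close>

lemma packet_pairing_bounded:
  fixes \<psi> :: "real \<Rightarrow> 'a::euclidean_space \<Rightarrow> complex"
  assumes L2: "\<And>s. 0 \<le> s \<Longrightarrow> \<psi> s \<in> L2_space"
    and cont: "\<And>s. 0 \<le> s \<Longrightarrow> ((\<lambda>u. L2_norm (\<lambda>x. \<psi> u x - \<psi> s x)) \<longlongrightarrow> 0) (at s within {0..})"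
    and e: "e > 0" and t: "0 \<le> t"
  shows "\<exists>K. \<forall>s\<in>{0..t}. \<forall>\<sigma> p q. cmod (LINT x|lebesgue. \<psi> s x * packet_ft e \<sigma> p q x) \<le> K"
proof -
  define \<kappa> where "\<kappa> = sqrt ((2 * pi * sqrt (pi / e)) ^ DIM('a))"
  have \<kappa>: "L2_norm (packet_ft e \<sigma> p q) = ennreal \<kappa>" for \<sigma> and p q :: 'a
    unfolding L2_norm_def nn_integral_packet_ft_square[OF e] \<kappa>_def using e by (simp add: Let_def)
  have \<kappa>0: "0 \<le> \<kappa>" using e by (simp add: \<kappa>_def)
  define Q where "Q = (\<lambda>s K. \<forall>\<sigma> p q. cmod (LINT x|lebesgue. \<psi> s x * packet_ft e \<sigma> p q x) \<le> K)"
  \<comment> \<open>The guard \<open>0 \<le> s\<close> is there because the small intervals around a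
    point of \<open>{0..t}\<close> may reach below 0.\<close>
  have "\<exists>K. \<forall>s\<in>{0..t}. 0 \<le> s \<longrightarrow> Q s K"
  proof (rule Bolzano[where P = "\<lambda>a b. \<exists>K. \<forall>s\<in>{a..b}. 0 \<le> s \<longrightarrow> Q s K", OF t])
    fix a b c :: real
    assume "\<exists>K. \<forall>s\<in>{a..b}. 0 \<le> s \<longrightarrow> Q s K" "\<exists>K. \<forall>s\<in>{b..c}. 0 \<le> s \<longrightarrow> Q s K"
    then obtain K1 K2 where "\<forall>s\<in>{a..b}. 0 \<le> s \<longrightarrow> Q s K1" "\<forall>s\<in>{b..c}. 0 \<le> s \<longrightarrow> Q s K2" by blast
    then have "\<forall>s\<in>{a..c}. 0 \<le> s \<longrightarrow> Q s (max K1 K2)"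
      unfolding Q_def by (metis atLeastAtMost_iff le_max_iff_disj linear)
    then show "\<exists>K. \<forall>s\<in>{a..c}. 0 \<le> s \<longrightarrow> Q s K" by blast
  next
    fix s0 :: real assume local: "0 \<le> s0" "s0 \<le> t"
    define K0 where "K0 = enn2real (L2_norm (\<psi> s0)) * \<kappa>"
    have fin: "L2_norm (\<psi> s0) < \<infinity>" using L2[of s0] local by (simp add: L2_space_def)
    have K0: "cmod (LINT x|lebesgue. \<psi> s0 x * packet_ft e \<sigma> p q x) \<le> K0" for \<sigma> p q
    proof -
      have "ennreal (cmod (LINT x|lebesgue. \<psi> s0 x * packet_ft e \<sigma> p q x)) \<le> L2_norm (\<psi> s0) * L2_norm (packet_ft e \<sigma> p q)"
        by (rule order_trans[OF cmod_integral_le_L1_norm L2_norm_mult_bound])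
           (use L2[of s0] local packet_ft_L2[OF e] in \<open>auto intro: L2_space_measurable\<close>)
      also have "\<dots> = ennreal K0" using fin \<kappa>0 by (simp add: \<kappa> K0_def ennreal_mult)
      finally show ?thesis using \<kappa>0 by (simp add: K0_def)
    qed
    have "\<forall>\<^sub>F u in at s0 within {0..}. L2_norm (\<lambda>x. \<psi> u x - \<psi> s0 x) < 1"
      using cont[of s0] local by (auto dest: order_tendstoD(2)[of _ _ _ 1])
    then obtain d where d: "d > 0" "\<And>u. 0 \<le> u \<Longrightarrow> u \<noteq> s0 \<Longrightarrow> dist u s0 < d \<Longrightarrow> L2_norm (\<lambda>x. \<psi> u x - \<psi> s0 x) < 1"
      unfolding eventually_at by auto
    have Q: "Q u (K0 + \<kappa>)" if u: "0 \<le> u" "dist u s0 < d" for u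
      unfolding Q_def
    proof (intro allI)
      fix \<sigma> and p q :: 'a
      let ?w = "packet_ft e \<sigma> p q"
      show "cmod (LINT x|lebesgue. \<psi> u x * ?w x) \<le> K0 + \<kappa>"
      proof (cases "u = s0")
        case True
        then show ?thesis using K0[of \<sigma> p q] \<kappa>0 by simp
      next
        case False
        have "ennreal (cmod ((LINT x|lebesgue. \<psi> u x * ?w x) - (LINT x|lebesgue. \<psi> s0 x * ?w x))) \<le> L2_norm (\<lambda>x. \<psi> u x - \<psi> s0 x) * L2_norm ?w"
          using L2[of u] L2[of s0] local u packet_ft_L2[OF e]
          by (intro cmod_integral_diff_le_L2 L2_space_measurable integrable_mult_L2) auto
        also have "\<dots> \<le> 1 * ennreal \<kappa>" unfolding \<kappa> using d(2)[OF u(1) False u(2)] by (intro mult_right_mono) auto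
        finally have "cmod ((LINT x|lebesgue. \<psi> u x * ?w x) - (LINT x|lebesgue. \<psi> s0 x * ?w x)) \<le> \<kappa>"
          using \<kappa>0 by simp
        then show ?thesis using K0[of \<sigma> p q] norm_triangle_sub[of "LINT x|lebesgue. \<psi> u x * ?w x" "LINT x|lebesgue. \<psi> s0 x * ?w x"] by linarith
      qed
    qed
    show "\<exists>d>0. \<forall>a b. a \<le> s0 \<and> s0 \<le> b \<and> b - a < d \<longrightarrow> (\<exists>K. \<forall>s\<in>{a..b}. 0 \<le> s \<longrightarrow> Q s K)"
    proof (rule exI[of _ d], intro conjI allI impI)
      show "d > 0" by fact
      fix a b assume "a \<le> s0 \<and> s0 \<le> b \<and> b - a < d"
      then have "\<forall>s\<in>{a..b}. 0 \<le> s \<longrightarrow> Q s (K0 + \<kappa>)" by (auto intro!: Q simp: dist_real_def)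
      then show "\<exists>K. \<forall>s\<in>{a..b}. 0 \<le> s \<longrightarrow> Q s K" by blast
    qed
  qed
  then show ?thesis by (auto simp: Q_def)
qed

text \<open>The weight \<open>exp (- \<delta> |x|\<^sup>2 / 2)\<close> serves to make an \<open>L\<^sup>2\<close> function integrable.\<close>

lemma gauss_damped:
  fixes x y :: "'a::euclidean_space"
  assumes e: "e > 0" and \<delta>: "\<delta> > 0"
  defines "e' \<equiv> e / (1 + \<delta> * e)" and "C \<equiv> sqrt (1 / (1 + \<delta> * e)) ^ DIM('a) * exp (- (\<delta> / (1 + \<delta> * e) * (norm y)\<^sup>2 / 2))"
  shows "of_real (exp (- (\<delta> * (norm x)\<^sup>2 / 2))) * gauss (of_real e) (x - y)
       = of_real C * gauss (of_real e') (x - y /\<^sub>R (1 + \<delta> * e))" and "0 \<le> C" and "C \<le> 1" and "e' > 0"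
proof -
  \<comment> \<open>Completing the square: inverse widths add,
    \<open>\<delta> + 1 / e = 1 / e'\<close>, and the centre \<open>y\<close> is contracted by
    \<open>k\<close>. The factor \<open>C\<close> combines the ratio of the normalisations with the
    exponential left over.\<close>
  define k where "k = 1 + \<delta> * e"
  have k: "k > 1" using e \<delta> by (simp add: k_def)
  show e': "e' > 0" using e k by (simp add: e'_def flip: k_def)
  have "k * (norm (x - y /\<^sub>R k))\<^sup>2 = k * (norm x)\<^sup>2 - 2 * (x \<bullet> y) + (norm y)\<^sup>2 / k"
    using k unfolding power2_norm_eq_inner
    by (simp add: inner_diff inner_commute algebra_simps power2_eq_square divide_simps)
  moreover have "(norm (x - y))\<^sup>2 = (norm x)\<^sup>2 - 2 * (x \<bullet> y) + (norm y)\<^sup>2"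
    unfolding power2_norm_eq_inner by (simp add: inner_diff inner_commute algebra_simps)
  ultimately have sq: "\<delta> * (norm x)\<^sup>2 / 2 + (norm (x - y))\<^sup>2 / (2 * e) = \<delta> / k * (norm y)\<^sup>2 / 2 + (norm (x - y /\<^sub>R k))\<^sup>2 / (2 * e')"
  proof -
    assume *: "k * (norm (x - y /\<^sub>R k))\<^sup>2 = k * (norm x)\<^sup>2 - 2 * (x \<bullet> y) + (norm y)\<^sup>2 / k"
      and **: "(norm (x - y))\<^sup>2 = (norm x)\<^sup>2 - 2 * (x \<bullet> y) + (norm y)\<^sup>2"
    have "(norm (x - y /\<^sub>R k))\<^sup>2 / (2 * e') = (k * (norm (x - y /\<^sub>R k))\<^sup>2) / (2 * e)"
      by (simp add: e'_def flip: k_def)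
    then have "\<delta> / k * (norm y)\<^sup>2 / 2 + (norm (x - y /\<^sub>R k))\<^sup>2 / (2 * e')
        = \<delta> / k * (norm y)\<^sup>2 / 2 + (k * (norm x)\<^sup>2 - 2 * (x \<bullet> y) + (norm y)\<^sup>2 / k) / (2 * e)"
      unfolding * by simp
    also have "\<dots> = (norm y)\<^sup>2 * ((\<delta> * e + 1) / k) / (2 * e) + (k * (norm x)\<^sup>2 - 2 * (x \<bullet> y)) / (2 * e)"
      using e k by (simp add: field_simps)
    also have "(\<delta> * e + 1) / k = 1" using k by (simp add: k_def)
    also have "(norm y)\<^sup>2 * 1 / (2 * e) + (k * (norm x)\<^sup>2 - 2 * (x \<bullet> y)) / (2 * e) = \<delta> * (norm x)\<^sup>2 / 2 + (norm (x - y))\<^sup>2 / (2 * e)"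
      unfolding ** using e by (simp add: k_def field_simps)
    finally show ?thesis by simp
  qed
  have "sqrt (1 / k) * sqrt (2 * pi / e') = sqrt (2 * pi / e)"
    using k by (simp add: e'_def flip: k_def real_sqrt_mult)
  then have "sqrt (2 * pi / e) ^ DIM('a) = sqrt (1 / k) ^ DIM('a) * sqrt (2 * pi / e') ^ DIM('a)"
    by (simp only: power_mult_distrib[symmetric])
  then have "exp (- (\<delta> * (norm x)\<^sup>2 / 2)) * (sqrt (2 * pi / e) ^ DIM('a) * exp (- ((norm (x - y))\<^sup>2 / (2 * e))))
      = C * (sqrt (2 * pi / e') ^ DIM('a) * exp (- ((norm (x - y /\<^sub>R k))\<^sup>2 / (2 * e'))))"
    using sq by (simp add: C_def mult_ac flip: k_def exp_add)
  then show "of_real (exp (- (\<delta> * (norm x)\<^sup>2 / 2))) * gauss (of_real e) (x - y)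
       = of_real C * gauss (of_real e') (x - y /\<^sub>R (1 + \<delta> * e))"
    unfolding gauss_of_real[OF e] gauss_of_real[OF e'] k_def[symmetric] of_real_mult[symmetric] by simp
  show "0 \<le> C" using k by (simp add: C_def flip: k_def)
  have "sqrt (1 / k) ^ DIM('a) * exp (- (\<delta> / k * (norm y)\<^sup>2 / 2)) \<le> 1 * 1"
    using k \<delta> by (intro mult_mono power_le_one) auto
  then show "C \<le> 1" by (simp add: C_def flip: k_def)
qed

text \<open>After damping, \<open>\<psi>\<close> is integrable and the convolution criterion
  applies. The damping is shifted onto the Gaussian, which becomes another centred Gaussian times a
  factor \<open>C \<le> 1\<close>; hence the bound \<open>M\<close> is uniform in the damping, which
  can then be removed.\<close>

lemma AE_norm_le_of_packets:
  fixes \<psi> :: "'a::euclidean_space \<Rightarrow> complex"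
  assumes \<psi>: "\<psi> \<in> L2_space"
    and M: "\<And>e q. e > 0 \<Longrightarrow> cmod (LINT x|lebesgue. \<psi> x * packet_ft e 0 0 q x) \<le> M"
  shows "AE x in lebesgue. cmod (\<psi> x) \<le> M / (2 * pi) ^ DIM('a)"
proof -
  have damped: "AE x in lebesgue. cmod (\<psi> x * of_real (exp (- (\<delta> * (norm x)\<^sup>2 / 2)))) \<le> M / (2 * pi) ^ DIM('a)"
    if \<delta>: "\<delta> > 0" for \<delta>
  proof (rule AE_norm_le_of_convolution)
    have "packet \<delta> 0 0 0 x = of_real (exp (- (\<delta> * (norm x)\<^sup>2 / 2)))" for x :: 'a
      by (simp add: packet_def flip: exp_of_real)
    then show "integrable lebesgue (\<lambda>x. \<psi> x * of_real (exp (- (\<delta> * (norm x)\<^sup>2 / 2))))"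
      using integrable_mult_L2[OF \<psi> packet_L2[OF \<delta>, of 0 0 0]] by simp
    fix e :: real and y :: 'a assume e: "e > 0"
    define C where "C = sqrt (1 / (1 + \<delta> * e)) ^ DIM('a) * exp (- (\<delta> / (1 + \<delta> * e) * (norm y)\<^sup>2 / 2))"
    let ?w = "packet_ft (e / (1 + \<delta> * e)) 0 0 (y /\<^sub>R (1 + \<delta> * e))"
    note d = gauss_damped(1)[OF e \<delta>, of _ y, folded C_def] gauss_damped(2,3)[OF e \<delta>, of y, folded C_def] gauss_damped(4)[OF e \<delta>]
    have "(LINT x|lebesgue. \<psi> x * of_real (exp (- (\<delta> * (norm x)\<^sup>2 / 2))) * gauss (of_real e) (x - y))
        = (LINT x|lebesgue. of_real C * (\<psi> x * ?w x))"
      unfolding mult.assoc d(1) packet_ft_centred by (simp only: mult.left_commute)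
    also have "cmod \<dots> = C * cmod (LINT x|lebesgue. \<psi> x * ?w x)"
      using d(2) by (simp add: norm_mult)
    also have "\<dots> \<le> 1 * cmod (LINT x|lebesgue. \<psi> x * ?w x)"
      by (rule mult_right_mono[OF d(3)]) simp
    also have "\<dots> \<le> M" using M[OF d(4)] by simp
    finally show "cmod (LINT x|lebesgue. \<psi> x * of_real (exp (- (\<delta> * (norm x)\<^sup>2 / 2))) * gauss (of_real e) (x - y)) \<le> M" .
  qed
  \<comment> \<open>Restricting \<open>\<delta>\<close> to a sequence keeps the union of the
    exceptional sets null.\<close>
  then have "AE x in lebesgue. \<forall>n. cmod (\<psi> x * of_real (exp (- (1 / real (Suc n) * (norm x)\<^sup>2 / 2)))) \<le> M / (2 * pi) ^ DIM('a)"
    unfolding AE_all_countable by (intro allI damped) simp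
  then show ?thesis
  proof eventually_elim
    case (elim x)
    have "(\<lambda>n. cmod (\<psi> x * of_real (exp (- (1 / real (Suc n) * (norm x)\<^sup>2 / 2))))) \<longlonglongrightarrow> cmod (\<psi> x * of_real (exp (- (0 * (norm x)\<^sup>2 / 2))))"
      by (intro tendsto_intros LIMSEQ_Suc[OF lim_1_over_n]) auto
    then show ?case using elim by (intro LIMSEQ_le_const2[of _ "cmod (\<psi> x)"]) auto
  qed
qed

section \<open>Assembly of the decay estimate\<close>

lemma interaction_dispersive_bound:
  fixes V \<psi> :: "'a::euclidean_space \<Rightarrow> complex"
  assumes V: "V \<in> borel_measurable lebesgue" "L1_cap_L2_norm V \<le> ennreal A" and "0 \<le> A"
    and \<psi>: "\<psi> \<in> borel_measurable lebesgue" "L2_plus_Linf_norm \<psi> \<le> ennreal R" and "0 \<le> R"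
    and e: "e > 0" and s: "s > 0"
  shows "cmod (LINT x|lebesgue. V x * \<psi> x * packet_ft e s p q x) \<le> sqrt (2 * pi / s) ^ DIM('a) * (A * R)"
proof -
  have fin: "L1_cap_L2_norm V < \<infinity>" using V(2) by (auto intro: le_less_trans)
  have m: "(\<lambda>x. V x * \<psi> x) \<in> borel_measurable lebesgue" using V \<psi> by auto
  have nn: "0 \<le> sqrt (2 * pi / s) ^ DIM('a)" using s by simp
  have "ennreal (cmod (LINT x|lebesgue. V x * \<psi> x * packet_ft e s p q x))
      \<le> ennreal (sqrt (2 * pi / s) ^ DIM('a)) * L1_norm (\<lambda>x. V x * \<psi> x)"
    by (rule cmod_integral_mult_bounded[OF cmod_packet_ft_le_time[OF e s] nn m])
  also have "\<dots> \<le> ennreal (sqrt (2 * pi / s) ^ DIM('a)) * (L1_cap_L2_norm V * L2_plus_Linf_norm \<psi>)"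
    by (intro mult_left_mono L1_norm_mult_le V \<psi> fin) simp
  also have "\<dots> \<le> ennreal (sqrt (2 * pi / s) ^ DIM('a)) * (ennreal A * ennreal R)"
    by (intro mult_left_mono mult_mono V \<psi>) auto
  also have "\<dots> = ennreal (sqrt (2 * pi / s) ^ DIM('a) * (A * R))"
    using assms nn by (simp add: ennreal_mult)
  finally show ?thesis using assms nn by (subst (asm) ennreal_le_iff) auto
qed

text \<open>In \<open>D\<close>, the summand 1 stems from the free evolution of
  \<open>\<psi>0\<close> and the other one from the interaction up to \<open>r\<close>:
  \<open>2 powr (real d / 2)\<close> arises from passing from \<open>t / 2\<close> to
  \<open>t\<close>, and \<open>2 + 2 powr (3/2) * 2\<close> bounds the time integral. The absolute
  value of \<open>C1\<close> covers either sign. The exponential is Gronwall's factor for at most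
  one unit of time, and the final denominator is the mass of the Gaussians.\<close>

lemma solution_decay:
  fixes V :: "real \<Rightarrow> 'a::euclidean_space \<Rightarrow> complex" and \<psi>0 :: "'a \<Rightarrow> complex" and A B C1 t :: real
  defines "d \<equiv> DIM('a)"
  defines "D \<equiv> sqrt (2 * pi) ^ d * (1 + A * (\<bar>C1\<bar> * (2 powr (real d / 2) * (2 + 2 powr (3/2) * 2))))"
  assumes d: "d \<ge> 3" and A: "0 \<le> A" and B: "0 \<le> B"
    and Vm: "\<And>\<tau>. 0 \<le> \<tau> \<Longrightarrow> V \<tau> \<in> borel_measurable lebesgue"
    and VA: "\<And>\<tau>. 0 \<le> \<tau> \<Longrightarrow> L1_cap_L2_norm (V \<tau>) \<le> ennreal A"
    and VB: "\<And>\<tau>. 0 \<le> \<tau> \<Longrightarrow> L1_norm (fourier (V \<tau>)) \<le> ennreal B"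
    and \<psi>0: "\<psi>0 \<in> L1_cap_L2_space"
    and sol: "schroedinger_solution V \<psi>0 \<psi>"
    and decay: "\<And>\<tau>. 0 \<le> \<tau> \<Longrightarrow> L2_plus_Linf_norm (\<psi> \<tau>)
       \<le> ennreal (C1 * sqrt (1 + \<tau>\<^sup>2) powr (- real d / 2)) * L1_cap_L2_norm \<psi>0"
    and t: "t > 0"
  shows "Linf_norm (\<psi> t) \<le> ennreal (D * exp (B / (2 * pi) ^ d) / (2 * pi) ^ d * t powr (- real d / 2)) * L1_cap_L2_norm \<psi>0"
proof -
  define N where "N = enn2real (L1_cap_L2_norm \<psi>0)"
  have N: "L1_cap_L2_norm \<psi>0 = ennreal N" and N0: "0 \<le> N"
    using \<psi>0 by (auto simp: N_def L1_cap_L2_space_def)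
  have \<psi>0m: "\<psi>0 \<in> borel_measurable lebesgue" using \<psi>0 by (simp add: L1_cap_L2_space_def)
  have \<psi>: "\<psi> \<tau> \<in> L2_space" if "0 \<le> \<tau>" for \<tau>
    using sol that by (simp add: schroedinger_solution_def)
  define h where "h = real d / 2"
  have h: "h \<ge> 3/2" "- real d / 2 = - h" using d by (auto simp: h_def)
  define \<beta> where "\<beta> = B / (2 * pi) ^ d"
  have \<beta>0: "0 \<le> \<beta>" using B by (simp add: \<beta>_def)
  have V1: "integrable lebesgue (V \<tau>)" if "0 \<le> \<tau>" for \<tau>
  proof -
    have "L1_norm (V \<tau>) \<le> L1_cap_L2_norm (V \<tau>)" by (simp add: L1_cap_L2_norm_def)
    also have "\<dots> < \<infinity>" using VA[OF that] by (auto intro: le_less_trans)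
    finally show ?thesis using Vm[OF that] by (simp add: integrable_iff_L1_norm)
  qed
  have V2: "integrable lebesgue (fourier (V \<tau>))" if "0 \<le> \<tau>" for \<tau>
  proof -
    have "L1_norm (fourier (V \<tau>)) < \<infinity>" using VB[OF that] by (auto intro: le_less_trans)
    then show ?thesis using fourier_measurable[OF Vm[OF that]] by (simp add: integrable_iff_L1_norm)
  qed
  have V3: "(LINT \<xi>|lebesgue. cmod (fourier (V \<tau>) \<xi>)) \<le> B" if "0 \<le> \<tau>" for \<tau>
  proof -
    have "ennreal (LINT \<xi>|lebesgue. cmod (fourier (V \<tau>) \<xi>)) = L1_norm (fourier (V \<tau>))"
      unfolding L1_norm_def by (rule nn_integral_eq_integral[symmetric]) (use V2[OF that] in auto)
    then have "ennreal (LINT \<xi>|lebesgue. cmod (fourier (V \<tau>) \<xi>)) \<le> ennreal B" using VB[OF that] by simp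
    then show ?thesis using B by simp
  qed
  define M where "M = D * t powr (- h) * N"
  have D_eq: "D = sqrt (2 * pi) ^ d * (1 + A * (\<bar>C1\<bar> * (2 powr h * (2 + 2 powr (3/2) * 2))))"
    by (simp add: D_def h_def)
  have M0: "0 \<le> M" unfolding M_def D_eq using A N0 by (intro mult_nonneg_nonneg add_nonneg_nonneg) auto
  have key: "cmod (LINT x|lebesgue. \<psi> t x * packet_ft e 0 0 q x) \<le> M * exp \<beta>" if e: "e > 0" for e and q :: 'a
  proof -
    define r where "r = max 0 (t - 1)"
    have r: "0 \<le> r" "r \<le> t" "t - r \<le> 1" using t by (auto simp: r_def)
    define a where "a = (\<lambda>s (p, q). LINT x|lebesgue. \<psi> s x * packet_ft e (t - s) p q x)"
    define b where "b = (\<lambda>s (p, q). LINT x|lebesgue. V s x * \<psi> s x * packet_ft e (t - s) p q x)"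
    have duhamel: "\<exists>c. ((\<lambda>\<tau>. b \<tau> i) has_integral c) {0..s} \<and>
        a s i = (LINT x|lebesgue. \<psi>0 x * packet_ft e t (fst i) (snd i) x) - \<i> * c" if "0 \<le> s" for s i
      using duhamel_packet[OF sol e that, of t "fst i" "snd i"] by (simp add: a_def b_def case_prod_unfold)
    have b_int: "(\<lambda>\<tau>. b \<tau> i) integrable_on {0..s}" if "0 \<le> s" for s i
      using duhamel[OF that, of i] by (auto intro: has_integral_integrable)
    have a_eq: "a s i = (LINT x|lebesgue. \<psi>0 x * packet_ft e t (fst i) (snd i) x) - \<i> * integral {0..s} (\<lambda>\<tau>. b \<tau> i)"
      if "0 \<le> s" for s i
      using duhamel[OF that, of i] by (auto dest: integral_unique)
    have "cmod (a t (0, q)) \<le> M * exp (\<beta> * (t - r))"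
    proof -
      obtain K where K: "\<forall>s\<in>{0..t}. \<forall>\<sigma> p q. cmod (LINT x|lebesgue. \<psi> s x * packet_ft e \<sigma> p q x) \<le> K"
        using packet_pairing_bounded[of \<psi> e t] \<psi> e sol t by (auto simp: schroedinger_solution_def)
      show ?thesis
      proof (rule gronwall_family[where a = a and b = b and c = "\<lambda>s i. integral {r..s} (\<lambda>\<tau>. b \<tau> i)" and K = K])
        fix s i assume s: "r \<le> s" "s \<le> t"
        have ic: "integral {0..r} (\<lambda>\<tau>. b \<tau> i) + integral {r..s} (\<lambda>\<tau>. b \<tau> i) = integral {0..s} (\<lambda>\<tau>. b \<tau> i)"
          by (rule Henstock_Kurzweil_Integration.integral_combine) (use r s b_int in auto)
        have "0 \<le> s" using r s by simp
        then have "a s i = a r i - \<i> * integral {r..s} (\<lambda>\<tau>. b \<tau> i)"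
          unfolding a_eq[OF \<open>0 \<le> s\<close>] a_eq[OF r(1)] ic[symmetric] by (simp add: algebra_simps)
        moreover have "(\<lambda>\<tau>. b \<tau> i) integrable_on {r..s}"
          by (rule integrable_on_subinterval[OF b_int[of s i]]) (use r s in auto)
        ultimately show "((\<lambda>\<tau>. b \<tau> i) has_integral integral {r..s} (\<lambda>\<tau>. b \<tau> i)) {r..s} \<and> a s i = a r i - \<i> * integral {r..s} (\<lambda>\<tau>. b \<tau> i)"
          by (simp add: integrable_integral)
        show "cmod (a s i) \<le> K" using K r s by (simp add: a_def case_prod_unfold)
      next
        fix \<tau> m and i :: "'a \<times> 'a" assume \<tau>: "r \<le> \<tau>" "\<tau> \<le> t" and m: "\<And>j. cmod (a \<tau> j) \<le> m"
        have \<tau>0: "0 \<le> \<tau>" using \<tau> r by simp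
        have m0: "0 \<le> m" using m[of i] norm_ge_zero order_trans by blast
        have "cmod (b \<tau> i) \<le> (LINT \<xi>|lebesgue. cmod (fourier (V \<tau>) \<xi>)) / (2 * pi) ^ DIM('a) * m"
          unfolding b_def case_prod_unfold
          by (rule potential_packet_bound[OF V1[OF \<tau>0] V2[OF \<tau>0] \<psi>[OF \<tau>0] e])
             (use m[of "(p, q)" for p q] in \<open>simp add: a_def\<close>)
        also have "\<dots> \<le> \<beta> * m"
          unfolding \<beta>_def d_def using V3[OF \<tau>0] m0 by (intro mult_right_mono divide_right_mono) auto
        finally show "cmod (b \<tau> i) \<le> \<beta> * m" .
      next
        fix i :: "'a \<times> 'a"
        let ?w = "packet_ft e t (fst i) (snd i)"
        have "ennreal (cmod (LINT x|lebesgue. \<psi>0 x * ?w x)) \<le> ennreal (sqrt (2 * pi / t) ^ d) * L1_norm \<psi>0"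
          unfolding d_def by (rule cmod_integral_mult_bounded[OF cmod_packet_ft_le_time[OF e t] _ \<psi>0m]) (use t in simp)
        also have "\<dots> \<le> ennreal (sqrt (2 * pi / t) ^ d) * ennreal N"
          unfolding N[symmetric] by (intro mult_left_mono) (auto simp: L1_cap_L2_norm_def)
        finally have free: "cmod (LINT x|lebesgue. \<psi>0 x * ?w x) \<le> sqrt (2 * pi) ^ d * t powr (- h) * N"
          using t N0 by (simp add: sqrt_power_eq_powr h_def flip: ennreal_mult)
        have inter: "cmod (integral {0..r} (\<lambda>\<tau>. b \<tau> i))
            \<le> sqrt (2 * pi) ^ d * (A * (\<bar>C1\<bar> * (2 powr h * (2 + 2 powr (3/2) * 2)))) * t powr (- h) * N"
        proof (cases "t \<le> 1")
          \<comment> \<open>Up to time 1 the Gronwall interval starts at 0, so only the free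
            evolution contributes at \<open>r\<close>.\<close>
          case True
          then have "r = 0" by (simp add: r_def)
          then show ?thesis using A N0 by simp
        next
          case False
          then have r_eq: "r = t - 1" and t1: "t \<ge> 1" by (auto simp: r_def)
          define g where "g = (\<lambda>\<tau>. (t - \<tau>) powr (- (3/2)) + 2 powr (3/2) * (1 + \<tau>) powr (- (3/2)))"
          define L where "L = sqrt (2 * pi) ^ d * A * \<bar>C1\<bar> * N * (t / 2) powr (- h)"
          have L0: "0 \<le> L" using A N0 by (simp add: L_def)
          obtain J where J: "(g has_integral J) {0..r}" "J \<le> 2 + 2 powr (3/2) * 2"
            using decay_convolution_integral[OF t1] unfolding g_def r_eq by blast
          have "norm (integral {0..r} (\<lambda>\<tau>. b \<tau> i)) \<le> integral {0..r} (\<lambda>\<tau>. L * g \<tau>)"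
          proof (rule integral_norm_bound_integral)
            show "(\<lambda>\<tau>. b \<tau> i) integrable_on {0..r}" using b_int r by simp
            show "(\<lambda>\<tau>. L * g \<tau>) integrable_on {0..r}"
              using has_integral_mult_right[OF J(1), of L] by (rule has_integral_integrable)
            fix \<tau> assume \<tau>: "\<tau> \<in> {0..r}"
            then have \<tau>': "0 \<le> \<tau>" "\<tau> \<le> t - 1" "t - \<tau> > 0" using r_eq by auto
            define R where "R = \<bar>C1\<bar> * sqrt (1 + \<tau>\<^sup>2) powr (- h) * N"
            have R0: "0 \<le> R" using N0 by (simp add: R_def)
            have "L2_plus_Linf_norm (\<psi> \<tau>) \<le> ennreal (C1 * sqrt (1 + \<tau>\<^sup>2) powr (- h)) * ennreal N"
              using decay[OF \<tau>'(1)] unfolding h(2) N .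
            also have "\<dots> \<le> ennreal (\<bar>C1\<bar> * sqrt (1 + \<tau>\<^sup>2) powr (- h)) * ennreal N"
              by (intro mult_right_mono ennreal_leI) auto
            also have "\<dots> = ennreal R" using N0 by (simp add: R_def ennreal_mult)
            finally have dec: "L2_plus_Linf_norm (\<psi> \<tau>) \<le> ennreal R" .
            have "cmod (b \<tau> i) \<le> sqrt (2 * pi / (t - \<tau>)) ^ d * (A * R)"
              unfolding b_def case_prod_unfold d_def
              by (rule interaction_dispersive_bound[OF Vm[OF \<tau>'(1)] VA[OF \<tau>'(1)] A L2_space_measurable[OF \<psi>[OF \<tau>'(1)]] dec R0 e \<tau>'(3)])
            also have "\<dots> = sqrt (2 * pi) ^ d * A * \<bar>C1\<bar> * N * ((t - \<tau>) powr (- h) * sqrt (1 + \<tau>\<^sup>2) powr (- h))"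
              unfolding sqrt_power_eq_powr[OF \<tau>'(3)] h(2) R_def by (simp only: mult_ac)
            also have "\<dots> \<le> sqrt (2 * pi) ^ d * A * \<bar>C1\<bar> * N * ((t / 2) powr (- h) * g \<tau>)"
              unfolding g_def by (intro mult_left_mono decay_convolution_pointwise t1 h \<tau>') (use A N0 in simp)
            also have "\<dots> = L * g \<tau>" by (simp add: L_def mult_ac)
            finally show "norm (b \<tau> i) \<le> L * g \<tau>" .
          qed
          also have "\<dots> = L * J" using has_integral_mult_right[OF J(1), of L] by (rule integral_unique)
          also have "\<dots> \<le> L * (2 + 2 powr (3/2) * 2)" by (rule mult_left_mono[OF J(2) L0])
          also have "(t / 2) powr (- h) = 2 powr h * t powr (- h)"
            using t by (simp only: powr_divide powr_minus) (simp add: field_simps)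
          then have "L * (2 + 2 powr (3/2) * 2) = sqrt (2 * pi) ^ d * (A * (\<bar>C1\<bar> * (2 powr h * (2 + 2 powr (3/2) * 2)))) * t powr (- h) * N"
            unfolding L_def by (simp only: mult_ac)
          finally show ?thesis .
        qed
        have "cmod (a r i) \<le> cmod (LINT x|lebesgue. \<psi>0 x * ?w x) + cmod (integral {0..r} (\<lambda>\<tau>. b \<tau> i))"
          unfolding a_eq[OF r(1)] by (rule order_trans[OF norm_triangle_ineq4]) (simp add: norm_mult)
        also have "\<dots> \<le> sqrt (2 * pi) ^ d * t powr (- h) * N
            + sqrt (2 * pi) ^ d * (A * (\<bar>C1\<bar> * (2 powr h * (2 + 2 powr (3/2) * 2)))) * t powr (- h) * N"
          by (rule add_mono[OF free inter])
        also have "\<dots> = M" unfolding M_def D_eq by (simp only: distrib_left distrib_right mult_1_right)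
        finally show "cmod (a r i) \<le> M" .
      qed (use r \<beta>0 in auto)
    qed
    also have "\<dots> \<le> M * exp (\<beta> * 1)"
      using M0 \<beta>0 r by (intro mult_left_mono) (auto intro!: mult_left_le)
    finally show ?thesis by (simp add: a_def)
  qed
  have "AE x in lebesgue. cmod (\<psi> t x) \<le> M * exp \<beta> / (2 * pi) ^ DIM('a)"
    using t by (intro AE_norm_le_of_packets \<psi> key) auto
  then have "Linf_norm (\<psi> t) \<le> ennreal (M * exp \<beta> / (2 * pi) ^ d)"
    unfolding Linf_norm_def d_def using L2_space_measurable[OF \<psi>[of t]] t
    by (intro esssup_I) (auto elim!: eventually_mono intro: ennreal_leI)
  also have "M * exp \<beta> / (2 * pi) ^ d = D * exp (B / (2 * pi) ^ d) / (2 * pi) ^ d * t powr (- real d / 2) * N"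
    by (simp add: M_def \<beta>_def h_def)
  also have "ennreal \<dots> = ennreal (D * exp (B / (2 * pi) ^ d) / (2 * pi) ^ d * t powr (- real d / 2)) * L1_cap_L2_norm \<psi>0"
    unfolding N by (rule ennreal_mult''[OF N0])
  finally show ?thesis .
qed

theorem proposition5p1:
  fixes C1 :: real and A B :: ennreal
  assumes "CARD('n::finite) \<ge> 3" and "A < \<infinity>" and "B < \<infinity>"
  shows "\<exists>C2::real. \<forall>(V :: real \<Rightarrow> real ^ 'n \<Rightarrow> complex) \<psi>0 \<psi>.
    (\<lambda>(t, x). V t x) \<in> borel_measurable (lebesgue_on ({0..} \<times> UNIV)) \<longrightarrow>
    (\<forall>t\<ge>0. V t \<in> borel_measurable lebesgue) \<longrightarrow>
    (SUP t\<in>{0..}. L1_cap_L2_norm (V t)) = A \<longrightarrow>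
    (SUP t\<in>{0..}. L1_norm (fourier (V t))) = B \<longrightarrow>
    \<psi>0 \<in> L1_cap_L2_space \<longrightarrow>
    schroedinger_solution V \<psi>0 \<psi> \<longrightarrow>
    (\<forall>t\<ge>0. L2_plus_Linf_norm (\<psi> t)
       \<le> ennreal (C1 * sqrt (1 + t\<^sup>2) powr (- real CARD('n) / 2)) * L1_cap_L2_norm \<psi>0) \<longrightarrow>
    (\<forall>t>0. Linf_norm (\<psi> t)
       \<le> ennreal (C2 * \<bar>t\<bar> powr (- real CARD('n) / 2)) * L1_cap_L2_norm \<psi>0)"
proof -
  define d where "d = CARD('n)"
  define a b where "a = enn2real A" and "b = enn2real B"
  have a: "A = ennreal a" "0 \<le> a" and b: "B = ennreal b" "0 \<le> b"
    using assms by (auto simp: a_def b_def)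
  \<comment> \<open>Fixed before \<open>V\<close>, \<open>\<psi>0\<close> and \<open>\<psi>\<close>,
    and built from the dimension, \<open>C1\<close> and the two suprema alone.\<close>
  define C2 where "C2 = sqrt (2 * pi) ^ d * (1 + a * (\<bar>C1\<bar> * (2 powr (real d / 2) * (2 + 2 powr (3/2) * 2))))
    * exp (b / (2 * pi) ^ d) / (2 * pi) ^ d"
  show ?thesis
  proof (intro exI[of _ C2] allI impI)
    fix V :: "real \<Rightarrow> real ^ 'n \<Rightarrow> complex" and \<psi>0 \<psi> and t :: real
    assume Vm: "\<forall>t\<ge>0. V t \<in> borel_measurable lebesgue"
      and VA: "(SUP t\<in>{0..}. L1_cap_L2_norm (V t)) = A" and VB: "(SUP t\<in>{0..}. L1_norm (fourier (V t))) = B"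
      and \<psi>0: "\<psi>0 \<in> L1_cap_L2_space" and sol: "schroedinger_solution V \<psi>0 \<psi>"
      and decay: "\<forall>t\<ge>0. L2_plus_Linf_norm (\<psi> t)
       \<le> ennreal (C1 * sqrt (1 + t\<^sup>2) powr (- real CARD('n) / 2)) * L1_cap_L2_norm \<psi>0" and t: "t > 0"
    have dim: "DIM(real ^ 'n) = d" by (simp add: d_def)
    have "Linf_norm (\<psi> t) \<le> ennreal (C2 * t powr (- real d / 2)) * L1_cap_L2_norm \<psi>0"
      unfolding C2_def dim[symmetric]
    proof (rule solution_decay[OF _ a(2) b(2) _ _ _ \<psi>0 sol _ t])
      show "L1_cap_L2_norm (V \<tau>) \<le> ennreal a" if "0 \<le> \<tau>" for \<tau>
        unfolding a(1)[symmetric] VA[symmetric] using that by (intro SUP_upper) simp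
      show "L1_norm (fourier (V \<tau>)) \<le> ennreal b" if "0 \<le> \<tau>" for \<tau>
        unfolding b(1)[symmetric] VB[symmetric] using that by (intro SUP_upper) simp
    qed (use assms(1) Vm decay in simp_all)
    then show "Linf_norm (\<psi> t) \<le> ennreal (C2 * \<bar>t\<bar> powr (- real CARD('n) / 2)) * L1_cap_L2_norm \<psi>0"
      using t by (simp add: d_def)
  qed
qed

end
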